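(* Let $d,N\ge 1$, $M>0$, let $(x_i^0)_{i\in\{1,\dots,N\}}\in(\mathbb{R}^d)^N$, let $(m_i^0)_{i\in\{1,\dots,N\}}\in(0,M)^N$ satisfy $\sum_{i=1}^N m_i^0=M$, and let $x^*$ belong to the interior of the convex hull $\Omega(x^0)$ of the points $x_1^0,\dots,x_N^0$. Then for every $\varepsilon>0$ there exist $\alpha>0$, $t_\varepsilon\ge 0$ and a measurable control $u:\mathbb{R}^+\to\mathbb{R}^N$ with $|u_i(t)|\le\alpha$ for all $i\in\{1,\dots,N\}$ and all $t$, such that the corresponding solution $(x,m)$ of the controlled system $$\dot x_i=\frac1M\sum_{j=1}^N m_j\,a(\|x_i-x_j\|)(x_j-x_i),\qquad \dot m_i=m_iu_i,\qquad x_i(0)=x_i^0,\quad m_i(0)=m_i^0,\qquad i\in\{1,\dots,N\},$$ satisfies $$\|\bar x(t_\varepsilon)-x^*\|\le\varepsilon ,$$ and such that $u$ does not satisfy the mass-conservation constraint, i.e. it is not the case that $\sum_{i=1}^N m_i(t)u_i(t)=0$ for almost every $t\in\mathbb{R}^+$.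
   Context: Here $\mathbb{R}^+=[0,\infty)$. The interaction function $a\in C(\mathbb{R}^+,\mathbb{R}^+)$ is fixed; it is assumed that the map $s\mapsto a(\|s\|)s$ is locally Lipschitz on $\mathbb{R}^d$ and that $a(s)>0$ for all $s>0$. The constant $M=\sum_{i=1}^N m_i^0$ is the initial total mass (it stays fixed in the equation for $x_i$ even when $\sum_i m_i(t)$ varies). The convex hull is $\Omega(x^0)=\{\sum_{i=1}^N\xi_ix_i^0 : \xi\in[0,1]^N,\ \sum_{i=1}^N\xi_i=1\}$, and its interior is taken in $\mathbb{R}^d$. The weighted barycenter is $\bar x(t)=\frac{1}{\sum_{i=1}^N m_i(t)}\sum_{i=1}^N m_i(t)x_i(t)$. Since controls are only measurable, solutions are absolutely continuous functions satisfying the differential equations for almost every $t$, and constraints on $u$ are understood for almost every $t$. *)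

theory Defs
  imports "HOL-Analysis.Analysis"
begin

(* The usual epsilon-delta notion for functions; the library only has absolute continuity
   of measures. *)
definition abs_continuous_on :: "real set \<Rightarrow> (real \<Rightarrow> 'a::metric_space) \<Rightarrow> bool" where
  "abs_continuous_on S f \<longleftrightarrow>
    (\<forall>\<epsilon>>0. \<exists>\<delta>>0. \<forall>D :: (real \<times> real) set.
       finite D \<longrightarrow>
       (\<forall>(p, q)\<in>D. p < q \<and> {p..q} \<subseteq> S) \<longrightarrow>
       disjoint_family_on (\<lambda>(p, q). {p<..<q}) D \<longrightarrow>
       (\<Sum>(p, q)\<in>D. q - p) < \<delta> \<longrightarrow>
       (\<Sum>(p, q)\<in>D. dist (f p) (f q)) < \<epsilon>)"

(* Trajectories are functions on the whole real line of which only the restriction to [0, \<infinity>)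
   is relevant. Absolute continuity on [0, \<infinity>) is required on every compact subinterval. M is
   a constant parameter, independent of the current total mass. *)
definition controlled_solution ::
  "(real \<Rightarrow> real) \<Rightarrow> real \<Rightarrow> (real^'d)^'n \<Rightarrow> real^'n \<Rightarrow> (real \<Rightarrow> real^'n)
    \<Rightarrow> (real \<Rightarrow> (real^'d)^'n) \<Rightarrow> (real \<Rightarrow> real^'n) \<Rightarrow> bool" where
  "controlled_solution a M x0 m0 u x m \<longleftrightarrow>
    x 0 = x0 \<and> m 0 = m0 \<and>
    (\<forall>T\<ge>0. abs_continuous_on {0..T} x \<and> abs_continuous_on {0..T} m) \<and>
    (AE t in lebesgue_on {0..}. \<forall>i.
       ((\<lambda>s. x s $ i) has_vector_derivative
          (1 / M) *\<^sub>R (\<Sum>j\<in>UNIV.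
             (m t $ j * a (norm (x t $ i - x t $ j))) *\<^sub>R (x t $ j - x t $ i)))
         (at t within {0..}) \<and>
       ((\<lambda>s. m s $ i) has_real_derivative m t $ i * u t $ i) (at t within {0..}))"

definition barycenter :: "real^'n \<Rightarrow> (real^'d)^'n \<Rightarrow> real^'d" where
  "barycenter m x = (1 / (\<Sum>i\<in>UNIV. m $ i)) *\<^sub>R (\<Sum>i\<in>UNIV. m $ i *\<^sub>R x $ i)"

definition mass_conserving :: "(real \<Rightarrow> real^'n) \<Rightarrow> (real \<Rightarrow> real^'n) \<Rightarrow> bool" where
  "mass_conserving m u \<longleftrightarrow>
    (AE t in lebesgue_on {0..}. (\<Sum>i\<in>UNIV. m t $ i * u t $ i) = 0)"

end

theory Submission
  imports Defs
begin

text \<open>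
  Write \<open>x\<^sup>* = \<Sum>\<^sub>i w\<^sub>i x\<^sub>i\<^sup>0\<close> with all weights positive. The constant control
  \<open>u\<^sub>i = ln (\<mu> w\<^sub>i / m\<^sub>i\<^sup>0) / \<tau>\<close> steers the masses to \<open>m\<^sub>i(\<tau>) = \<mu> w\<^sub>i\<close>. If \<open>\<mu>\<close> is smaller than every
  \<open>m\<^sub>i\<^sup>0\<close>, all controls are negative, so that the total mass strictly decreases while every mass stays
  below \<open>M\<close>; hence the velocities are bounded near the initial configuration independently of \<open>\<tau>\<close>.
  For small \<open>\<tau>\<close> the agents therefore hardly move, and the barycenter at time \<open>\<tau>\<close> is close
  to \<open>x\<^sup>*\<close>.
\<close>

text \<open>The conclusion quantifies over all solutions in the almost-everywhere sense, so its
  estimates may not be read off from one constructed trajectory. A constant control removes this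
  obstacle: along any absolutely continuous solution both right-hand sides are then continuous in
  time, and an almost-everywhere equation with continuous right-hand side holds at every time. The
  masses of an arbitrary solution are therefore explicit exponentials, and its positions obey a
  classical speed estimate. Existence is a separate matter, because the position field is only
  locally Lipschitz. The freedom in \<mu> comes from the barycenter: it is normalised by the current
  total mass, so only the proportions of the masses matter at time \<tau>. The rates are of order
  1/\<tau>; this is harmless because \<alpha> may depend on \<epsilon>, provided that the speed
  bound that determines \<tau> is fixed without reference to the rates.\<close>

section \<open>Absolutely continuous functions\<close>

text \<open>
  Take a tagged division that is fine for a gauge adapted to an open set \<open>U \<supseteq> N\<close> of small measure
  and to the derivative off \<open>N\<close>: absolute continuity bounds the increments over the
  intervals tagged in \<open>N\<close>, the vanishing derivative bounds the others.
\<close>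
lemma abs_continuous_on_zero_derivative_eq:
  fixes f :: "real \<Rightarrow> 'a::real_normed_vector"
  assumes "a \<le> b" and ac: "abs_continuous_on {a..b} f" and N: "negligible N"
    and der: "\<And>t. t \<in> {a..b} - N \<Longrightarrow> (f has_vector_derivative 0) (at t within {a..b})"
  shows "f b = f a"
proof -
  \<comment> \<open>The summand \<open>e\<close> pays for the intervals tagged in \<open>N\<close>,
    the summand \<open>e * (b - a)\<close> for all others.\<close>
  have "norm (f b - f a) \<le> e * (1 + (b - a))" if "e > 0" for e
  proof -
    obtain \<delta> where "\<delta> > 0" and \<delta>: "\<And>D :: (real \<times> real) set. finite D \<Longrightarrow>
        (\<forall>(p, q)\<in>D. p < q \<and> {p..q} \<subseteq> {a..b}) \<Longrightarrow>
        disjoint_family_on (\<lambda>(p, q). {p<..<q}) D \<Longrightarrow> (\<Sum>(p, q)\<in>D. q - p) < \<delta> \<Longrightarrow>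
        (\<Sum>(p, q)\<in>D. dist (f p) (f q)) < e"
      using ac \<open>e > 0\<close> unfolding abs_continuous_on_def by blast
    have "N \<in> sets lebesgue"
      using N by (auto simp: negligible_iff_null_sets)
    obtain U where U: "open U" "N \<subseteq> U" "U - N \<in> lmeasurable" "emeasure lebesgue (U - N) < ennreal \<delta>"
      using sets_lebesgue_outer_open[OF \<open>N \<in> sets lebesgue\<close> \<open>\<delta> > 0\<close>] by blast
    have NU: "N \<in> lmeasurable" "measure lebesgue N = 0"
      using N negligible_imp_measurable negligible_imp_measure0 by auto
    have Um: "U \<in> lmeasurable"
      using fmeasurable.Un[OF U(3) NU(1)] U(2) by (simp add: Un_absorb2)
    have "measure lebesgue U \<le> measure lebesgue (U - N) + measure lebesgue N"
      using measure_Un_le[of "U - N" lebesgue N] U(2,3) NU(1) by (simp add: Un_absorb2 fmeasurableD)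
    moreover have "measure lebesgue (U - N) < \<delta>"
      using U(3,4) \<open>\<delta> > 0\<close> by (simp add: emeasure_eq_measure2 ennreal_less_iff)
    ultimately have mU: "measure lebesgue U < \<delta>"
      using NU by simp
    have "\<exists>d>0. ball t d \<subseteq> U" if "t \<in> N" for t
      using U(1,2) that by (meson open_contains_ball subsetD)
    moreover have "\<exists>d>0. \<forall>y\<in>{a..b}. norm (y - t) < d \<longrightarrow> norm (f y - f t) \<le> e * norm (y - t)"
      if "t \<in> {a..b} - N" for t
      using der[OF that] \<open>e > 0\<close>
      unfolding has_vector_derivative_def has_derivative_within_alt by auto
    ultimately have "\<exists>d>0. (t \<in> N \<longrightarrow> ball t d \<subseteq> U) \<and> (t \<in> {a..b} - N \<longrightarrow>
        (\<forall>y\<in>{a..b}. norm (y - t) < d \<longrightarrow> norm (f y - f t) \<le> e * norm (y - t)))" for t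
      by (cases "t \<in> N"; cases "t \<in> {a..b}") (auto intro: exI[of _ 1])
    then obtain d where d0: "\<And>t. d t > 0" and dN: "\<And>t. t \<in> N \<Longrightarrow> ball t (d t) \<subseteq> U"
      and dd: "\<And>t y. t \<in> {a..b} - N \<Longrightarrow> y \<in> {a..b} \<Longrightarrow> norm (y - t) < d t \<Longrightarrow>
        norm (f y - f t) \<le> e * norm (y - t)"
      by metis
    have "gauge (\<lambda>t. ball t (d t))" using d0 by (simp add: gauge_def)
    then obtain p where p: "p tagged_division_of {a..b}" and fine: "(\<lambda>t. ball t (d t)) fine p"
      using fine_division_exists_real by blast
    have fin: "finite p" using p by blast
    have K: "\<exists>u v. u \<le> v \<and> K = {u..v} \<and> x \<in> {u..v} \<and> {u..v} \<subseteq> {a..b} \<and> {u..v} \<subseteq> ball x (d x)"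
      if xK: "(x, K) \<in> p" for x K
    proof -
      obtain u v where "K = cbox u v" using tagged_division_ofD(4)[OF p xK] by blast
      moreover have "x \<in> K" "K \<subseteq> {a..b}" using tagged_division_ofD(2,3)[OF p xK] by auto
      moreover have "K \<subseteq> ball x (d x)" using fineD[OF fine xK] .
      ultimately show ?thesis by (intro exI[of _ u] exI[of _ v]) auto
    qed
    define g where "g = (\<lambda>(x::real, K::real set). f (Sup K) - f (Inf K))"
    \<comment> \<open>Degenerate intervals are dropped, since \<open>abs_continuous_on\<close>
      speaks of \<open>p < q\<close> only; their increments vanish. The strict inequality also gives
      every member of \<open>q\<close> a nonempty interior.\<close>
    define q where "q = {(x, K) \<in> p. x \<in> N \<and> Inf K < Sup K}"
    define r where "r = {(x, K) \<in> p. x \<notin> N}"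
    have qp: "q \<subseteq> p" "r \<subseteq> p" by (auto simp: q_def r_def)
    have finq: "finite q" "finite r" using qp fin by (auto intro: finite_subset)
    have "f b - f a = sum g p"
      using additive_tagged_division_1[OF \<open>a \<le> b\<close> p, of f] by (simp add: g_def)
    also have "sum g p = sum g (q \<union> r)"
    proof (rule sum.mono_neutral_right[OF fin])
      show "q \<union> r \<subseteq> p" using qp by blast
      show "\<forall>i\<in>p - (q \<union> r). g i = 0"
      proof
        fix i assume i: "i \<in> p - (q \<union> r)"
        obtain x K' where "i = (x, K')" by fastforce
        with i K[of x K'] have "x \<in> N" "\<not> Inf K' < Sup K'" "\<exists>u v. u \<le> v \<and> K' = {u..v}"
          by (auto simp: q_def r_def)
        then have "Inf K' = Sup K'" by auto
        with \<open>i = (x, K')\<close> show "g i = 0" by (simp add: g_def)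
      qed
    qed
    also have "\<dots> = sum g q + sum g r"
      by (rule sum.union_disjoint) (use finq in \<open>auto simp: q_def r_def\<close>)
    finally have split: "f b - f a = sum g q + sum g r" .
    define ends where "ends = (\<lambda>(x::real, K::real set). (Inf K, Sup K))"
    have q_cases: "\<exists>x u v. i = (x, {u..v}) \<and> u < v \<and> x \<in> N \<and> (x, {u..v}) \<in> p \<and>
        {u..v} \<subseteq> {a..b} \<and> {u..v} \<subseteq> U \<and> ends i = (u, v) \<and> interior (snd i) = {u<..<v}" if "i \<in> q" for i
    proof -
      obtain x K' where i: "i = (x, K')" "(x, K') \<in> p" "x \<in> N" "Inf K' < Sup K'"
        using \<open>i \<in> q\<close> by (auto simp: q_def)
      obtain u v where uv: "u \<le> v" "K' = {u..v}" "{u..v} \<subseteq> {a..b}" "{u..v} \<subseteq> ball x (d x)"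
        using K[OF i(2)] by blast
      then have "{u..v} \<subseteq> U" using dN[OF i(3)] by blast
      with i uv show ?thesis by (intro exI[of _ x] exI[of _ u] exI[of _ v]) (auto simp: ends_def)
    qed
    have q_disj: "interior (snd i) \<inter> interior (snd j) = {}" if "i \<in> q" "j \<in> q" "i \<noteq> j" for i j
      using tagged_division_ofD(5)[OF p, of "fst i" "snd i" "fst j" "snd j"] that qp(1) by auto
    \<comment> \<open>Absolute continuity takes a set of pairs, so the tags must be forgotten
      without merging intervals. Two members with equal end points would share a nonempty interior,
      which a division forbids.\<close>
    have inj: "inj_on ends q"
    proof (rule inj_onI, rule ccontr)
      fix i j assume 1: "i \<in> q" "j \<in> q" "ends i = ends j" "i \<noteq> j"
      obtain u v where i: "u < v" "ends i = (u, v)" "interior (snd i) = {u<..<v}"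
        using q_cases[OF 1(1)] by blast
      obtain u' v' where j: "ends j = (u', v')" "interior (snd j) = {u'<..<v'}"
        using q_cases[OF 1(2)] by blast
      show False using q_disj[OF 1(1,2,4)] i j 1(3) by simp
    qed
    have dis: "disjoint_family_on (\<lambda>(p, q). {p<..<q}) (ends ` q)"
      unfolding disjoint_family_on_def
    proof (intro ballI impI)
      fix A B assume 1: "A \<in> ends ` q" "B \<in> ends ` q" "A \<noteq> B"
      then obtain i j where 2: "i \<in> q" "j \<in> q" "A = ends i" "B = ends j" "i \<noteq> j" by blast
      obtain u v where i: "ends i = (u, v)" "interior (snd i) = {u<..<v}"
        using q_cases[OF 2(1)] by blast
      obtain u' v' where j: "ends j = (u', v')" "interior (snd j) = {u'<..<v'}"
        using q_cases[OF 2(2)] by blast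
      show "(case A of (p, q) \<Rightarrow> {p<..<q}) \<inter> (case B of (p, q) \<Rightarrow> {p<..<q}) = {}"
        using q_disj[OF 2(1,2,5)] i j 2 by simp
    qed
    \<comment> \<open>The total length is the measure of a disjoint union of open intervals inside
      \<open>U\<close>.\<close>
    have len: "(\<Sum>(u, v)\<in>ends ` q. v - u) < \<delta>"
    proof -
      have "(\<Sum>(u, v)\<in>ends ` q. v - u) = (\<Sum>i\<in>ends ` q. measure lebesgue (case i of (u, v) \<Rightarrow> {u<..<v}))"
        by (intro sum.cong) (auto simp: ends_def q_def)
      also have "\<dots> = measure lebesgue (\<Union>i\<in>ends ` q. (case i of (u, v) \<Rightarrow> {u<..<v}))"
      proof (rule measure_finite_Union[symmetric, OF _ _ dis])
        show "emeasure lebesgue (case i of (u, v) \<Rightarrow> {u<..<v}) \<noteq> \<infinity>" if "i \<in> ends ` q" for i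
          using emeasure_bounded_finite[of "case i of (u, v) \<Rightarrow> {u<..<v}"] by (auto split: prod.splits)
      qed (use finq in auto)
      also have "\<dots> \<le> measure lebesgue U"
      proof (rule measure_mono_fmeasurable[OF _ _ Um])
        show "(\<Union>i\<in>ends ` q. case i of (u, v) \<Rightarrow> {u<..<v}) \<subseteq> U"
        proof (rule UN_least)
          fix A assume "A \<in> ends ` q"
          then obtain i where i: "i \<in> q" "A = ends i" by blast
          obtain u v where "{u..v} \<subseteq> U" "ends i = (u, v)" using q_cases[OF i(1)] by blast
          then show "(case A of (u, v) \<Rightarrow> {u<..<v}) \<subseteq> U" using i by auto
        qed
        show "(\<Union>i\<in>ends ` q. case i of (u, v) \<Rightarrow> {u<..<v}) \<in> sets lebesgue"
          by (rule sets.finite_UN) (use finq in auto)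
      qed
      also note mU
      finally show ?thesis .
    qed
    have "norm (sum g q) \<le> (\<Sum>i\<in>q. norm (g i))" by (rule norm_sum)
    also have "\<dots> = (\<Sum>i\<in>q. case ends i of (u, v) \<Rightarrow> dist (f u) (f v))"
      by (intro sum.cong) (auto simp: g_def ends_def dist_norm norm_minus_commute)
    also have "\<dots> = (\<Sum>(u, v)\<in>ends ` q. dist (f u) (f v))"
      by (simp add: sum.reindex[OF inj])
    also have "\<dots> < e"
    proof (rule \<delta>)
      show "\<forall>(u, v)\<in>ends ` q. u < v \<and> {u..v} \<subseteq> {a..b}"
      proof
        fix A assume "A \<in> ends ` q"
        then obtain i where i: "i \<in> q" "A = ends i" by blast
        obtain u v where "u < v" "{u..v} \<subseteq> {a..b}" "ends i = (u, v)" using q_cases[OF i(1)] by blast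
        with i show "case A of (u, v) \<Rightarrow> u < v \<and> {u..v} \<subseteq> {a..b}" by simp
      qed
    qed (use finq dis len in auto)
    finally have q_le: "norm (sum g q) < e" .
    have sums: "(\<Sum>(x, K)\<in>p. Sup K - Inf K) = b - a"
      using additive_tagged_division_1[OF \<open>a \<le> b\<close> p, of "\<lambda>x. x"] by simp
    have "norm (sum g r) \<le> (\<Sum>i\<in>r. norm (g i))" by (rule norm_sum)
    also have "\<dots> \<le> (\<Sum>i\<in>r. e * (case i of (x, K) \<Rightarrow> Sup K - Inf K))"
    proof (rule sum_mono)
      fix i assume "i \<in> r"
      then obtain x K' where i: "i = (x, K')" and xp: "(x, K') \<in> p" "x \<notin> N" by (auto simp: r_def)
      obtain u v where uv: "u \<le> v" "K' = {u..v}" "x \<in> {u..v}" "{u..v} \<subseteq> {a..b}" "{u..v} \<subseteq> ball x (d x)"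
        using K[OF xp(1)] by blast
      have x: "x \<in> {a..b} - N" using uv xp by blast
      have "u \<in> {u..v}" "v \<in> {u..v}" using uv by auto
      then have "u \<in> ball x (d x)" "v \<in> ball x (d x)" "u \<in> {a..b}" "v \<in> {a..b}" using uv by blast+
      then have "norm (f u - f x) \<le> e * norm (u - x)" "norm (f v - f x) \<le> e * norm (v - x)"
        using dd[OF x, of u] dd[OF x, of v] by (auto simp: dist_real_def)
      moreover have "norm (f v - f u) \<le> norm (f v - f x) + norm (f u - f x)"
        using norm_triangle_ineq4[of "f v - f x" "f u - f x"] by simp
      ultimately have "norm (f v - f u) \<le> e * norm (u - x) + e * norm (v - x)"
        by linarith
      \<comment> \<open>The tag lies between the end points, so its distances to them add up to the
        length.\<close>
      also have "\<dots> = e * (v - u)" using uv by (simp add: algebra_simps)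
      finally show "norm (g i) \<le> e * (case i of (x, K) \<Rightarrow> Sup K - Inf K)"
        using uv i by (simp add: g_def)
    qed
    also have "\<dots> \<le> (\<Sum>i\<in>p. e * (case i of (x, K) \<Rightarrow> Sup K - Inf K))"
    proof (rule sum_mono2[OF fin qp(2)])
      fix i assume "i \<in> p - r"
      then obtain x K' where i: "i = (x, K')" "(x, K') \<in> p" by (cases i) auto
      with K[OF i(2)] \<open>e > 0\<close> show "0 \<le> e * (case i of (x, K) \<Rightarrow> Sup K - Inf K)" by auto
    qed
    also have "\<dots> = e * (b - a)" by (simp add: sum_distrib_left[symmetric] sums)
    finally have r_le: "norm (sum g r) \<le> e * (b - a)" .
    have "norm (f b - f a) \<le> norm (sum g q) + norm (sum g r)"
      unfolding split by (rule norm_triangle_ineq)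
    with q_le r_le show ?thesis by (simp add: algebra_simps)
  qed
  note * = this
  have "norm (f b - f a) \<le> 0 + e" if "e > 0" for e
  proof -
    have "1 + (b - a) > 0" using \<open>a \<le> b\<close> by simp
    then show ?thesis using *[of "e / (1 + (b - a))"] \<open>e > 0\<close> by simp
  qed
  then have "norm (f b - f a) \<le> 0" by (rule field_le_epsilon)
  then show ?thesis by simp
qed

section \<open>Elementary properties of absolute continuity\<close>

lemma lipschitz_on_imp_abs_continuous_on:
  assumes L: "L-lipschitz_on S f"
  shows "abs_continuous_on S f"
  unfolding abs_continuous_on_def
proof (intro allI impI)
  fix e :: real assume "e > 0"
  have "L \<ge> 0" using L lipschitz_on_nonneg by blast
  show "\<exists>\<delta>>0. \<forall>D. finite D \<longrightarrow> (\<forall>(p, q)\<in>D. p < q \<and> {p..q} \<subseteq> S) \<longrightarrow>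
      disjoint_family_on (\<lambda>(p, q). {p<..<q}) D \<longrightarrow> (\<Sum>(p, q)\<in>D. q - p) < \<delta> \<longrightarrow>
      (\<Sum>(p, q)\<in>D. dist (f p) (f q)) < e"
  \<comment> \<open>The denominator \<open>L + 1\<close> covers the case
    \<open>L = 0\<close>.\<close>
  proof (intro exI[of _ "e / (L + 1)"] conjI allI impI)
    show "e / (L + 1) > 0" using \<open>L \<ge> 0\<close> \<open>e > 0\<close> by simp
    fix D :: "(real \<times> real) set"
    assume D: "\<forall>(p, q)\<in>D. p < q \<and> {p..q} \<subseteq> S" and s: "(\<Sum>(p, q)\<in>D. q - p) < e / (L + 1)"
    have "(\<Sum>(p, q)\<in>D. dist (f p) (f q)) \<le> (\<Sum>i\<in>D. L * (case i of (p, q) \<Rightarrow> q - p))"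
    proof (rule sum_mono, clarify)
      fix p q assume "(p, q) \<in> D"
      with D have "p < q" "{p..q} \<subseteq> S" by auto
      then have "p < q" "p \<in> S" "q \<in> S" by auto
      then show "dist (f p) (f q) \<le> L * (q - p)"
        using lipschitz_onD[OF L, of p q] by (simp add: dist_real_def)
    qed
    also have "\<dots> = L * (\<Sum>(p, q)\<in>D. q - p)" by (simp add: sum_distrib_left)
    also have "\<dots> \<le> L * (e / (L + 1))" using s \<open>L \<ge> 0\<close> by (intro mult_left_mono) auto
    also have "\<dots> < e" using \<open>L \<ge> 0\<close> \<open>e > 0\<close> by (simp add: field_simps)
    finally show "(\<Sum>(p, q)\<in>D. dist (f p) (f q)) < e" .
  qed
qed

lemma abs_continuous_on_diff:
  fixes f g :: "real \<Rightarrow> 'a::real_normed_vector"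
  assumes f: "abs_continuous_on S f" and g: "abs_continuous_on S g"
  shows "abs_continuous_on S (\<lambda>t. f t - g t)"
  unfolding abs_continuous_on_def
proof (intro allI impI)
  fix e :: real assume "e > 0"
  then have "e / 2 > 0" by simp
  obtain d1 where d1: "d1 > 0" "\<forall>D :: (real \<times> real) set. finite D \<longrightarrow>
      (\<forall>(p, q)\<in>D. p < q \<and> {p..q} \<subseteq> S) \<longrightarrow> disjoint_family_on (\<lambda>(p, q). {p<..<q}) D \<longrightarrow>
      (\<Sum>(p, q)\<in>D. q - p) < d1 \<longrightarrow> (\<Sum>(p, q)\<in>D. dist (f p) (f q)) < e / 2"
    using f \<open>e / 2 > 0\<close> unfolding abs_continuous_on_def by blast
  obtain d2 where d2: "d2 > 0" "\<forall>D :: (real \<times> real) set. finite D \<longrightarrow>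
      (\<forall>(p, q)\<in>D. p < q \<and> {p..q} \<subseteq> S) \<longrightarrow> disjoint_family_on (\<lambda>(p, q). {p<..<q}) D \<longrightarrow>
      (\<Sum>(p, q)\<in>D. q - p) < d2 \<longrightarrow> (\<Sum>(p, q)\<in>D. dist (g p) (g q)) < e / 2"
    using g \<open>e / 2 > 0\<close> unfolding abs_continuous_on_def by blast
  show "\<exists>\<delta>>0. \<forall>D. finite D \<longrightarrow> (\<forall>(p, q)\<in>D. p < q \<and> {p..q} \<subseteq> S) \<longrightarrow>
      disjoint_family_on (\<lambda>(p, q). {p<..<q}) D \<longrightarrow> (\<Sum>(p, q)\<in>D. q - p) < \<delta> \<longrightarrow>
      (\<Sum>(p, q)\<in>D. dist (f p - g p) (f q - g q)) < e"
  proof (intro exI[of _ "min d1 d2"] conjI allI impI)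
    show "min d1 d2 > 0" using d1 d2 by simp
    fix D :: "(real \<times> real) set"
    assume D: "finite D" "\<forall>(p, q)\<in>D. p < q \<and> {p..q} \<subseteq> S"
      "disjoint_family_on (\<lambda>(p, q). {p<..<q}) D" "(\<Sum>(p, q)\<in>D. q - p) < min d1 d2"
    have "(\<Sum>(p, q)\<in>D. dist (f p - g p) (f q - g q))
        \<le> (\<Sum>i\<in>D. (case i of (p, q) \<Rightarrow> dist (f p) (f q)) + (case i of (p, q) \<Rightarrow> dist (g p) (g q)))"
      by (rule sum_mono) (auto simp: dist_norm intro: order_trans[OF _ norm_triangle_ineq4] simp: algebra_simps)
    also have "\<dots> = (\<Sum>(p, q)\<in>D. dist (f p) (f q)) + (\<Sum>(p, q)\<in>D. dist (g p) (g q))"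
      by (simp add: sum.distrib)
    also have "\<dots> < e / 2 + e / 2" using d1(2) d2(2) D by (intro add_strict_mono) auto
    finally show "(\<Sum>(p, q)\<in>D. dist (f p - g p) (f q - g q)) < e" by simp
  qed
qed

text \<open>Families with a single interval suffice. That \<open>S\<close> is an interval guarantees
  that the segment between two of its points is an admissible member of such a family.\<close>

lemma abs_continuous_on_imp_continuous_on:
  assumes f: "abs_continuous_on S f" and S: "is_interval S"
  shows "continuous_on S f"
  unfolding continuous_on_iff
proof (intro ballI allI impI)
  fix t e :: real assume "t \<in> S" "e > 0"
  then obtain d where d: "d > 0" "\<And>D :: (real \<times> real) set. finite D \<Longrightarrow>
      (\<forall>(p, q)\<in>D. p < q \<and> {p..q} \<subseteq> S) \<Longrightarrow> disjoint_family_on (\<lambda>(p, q). {p<..<q}) D \<Longrightarrow>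
      (\<Sum>(p, q)\<in>D. q - p) < d \<Longrightarrow> (\<Sum>(p, q)\<in>D. dist (f p) (f q)) < e"
    using f unfolding abs_continuous_on_def by blast
  have *: "dist (f p) (f q) < e" if "p \<in> S" "q \<in> S" "p < q" "q - p < d" for p q
  proof -
    have "{p..q} \<subseteq> S"
      using S that(1,2) mem_is_interval_1_I[of S p q] by auto
    then show ?thesis using d(2)[of "{(p, q)}"] that by (simp add: disjoint_family_on_def)
  qed
  show "\<exists>d>0. \<forall>s\<in>S. dist s t < d \<longrightarrow> dist (f s) (f t) < e"
  proof (intro exI[of _ d] conjI ballI impI)
    fix s assume "s \<in> S" "dist s t < d"
    then consider "s = t" | "s < t" "t - s < d" | "t < s" "s - t < d"
      unfolding dist_real_def by linarith
    then show "dist (f s) (f t) < e"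
      using *[OF \<open>s \<in> S\<close> \<open>t \<in> S\<close>] *[OF \<open>t \<in> S\<close> \<open>s \<in> S\<close>] \<open>e > 0\<close>
      by cases (simp_all add: dist_commute)
  qed (use d in auto)
qed

section \<open>Derivatives, integrals and absolute continuity\<close>

lemma has_vector_derivative_bounded_imp_lipschitz_on:
  fixes f :: "real \<Rightarrow> 'a::real_normed_vector"
  assumes "convex S" and "\<And>t. t \<in> S \<Longrightarrow> (f has_vector_derivative f' t) (at t within S)"
    and "\<And>t. t \<in> S \<Longrightarrow> norm (f' t) \<le> B" and "B \<ge> 0"
  shows "B-lipschitz_on S f"
proof (rule lipschitz_onI[OF _ \<open>B \<ge> 0\<close>])
  fix s t assume st: "s \<in> S" "t \<in> S"
  have "norm (f s - f t) \<le> B * norm (s - t)"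
  proof (rule differentiable_bound[OF \<open>convex S\<close> _ _ st])
    show "(f has_derivative (\<lambda>h. h *\<^sub>R f' t)) (at t within S)" if "t \<in> S" for t
      using assms(2)[OF that] by (simp add: has_vector_derivative_def)
    show "onorm (\<lambda>h. h *\<^sub>R f' t) \<le> B" if "t \<in> S" for t
      using assms(3)[OF that] \<open>B \<ge> 0\<close>
      by (intro onorm_bound) (auto simp: mult.commute[of B] intro!: mult_left_mono)
  qed
  then show "dist (f s) (f t) \<le> B * dist s t" by (simp add: dist_norm)
qed

lemma has_vector_derivative_integral_half_line:
  fixes g :: "real \<Rightarrow> 'a::banach"
  assumes "continuous_on {0..} g" "t \<ge> 0"
  shows "((\<lambda>t. integral {0..t} g) has_vector_derivative g t) (at t within {0..})"
proof -
  have "((\<lambda>t. integral {0..t} g) has_vector_derivative g t) (at t within {0..t+1})"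
    using assms by (intro integral_has_vector_derivative) (auto intro: continuous_on_subset)
  moreover have "at t within {0..t+1} = at t within {0..}"
    by (rule at_within_nhd[of t "{..<t+1}"]) auto
  ultimately show ?thesis by simp
qed

lemma continuous_derivative_imp_abs_continuous_on:
  fixes f g :: "real \<Rightarrow> 'a::real_normed_vector"
  assumes der: "\<And>t. t \<ge> 0 \<Longrightarrow> (f has_vector_derivative g t) (at t within {0..})"
    and g: "continuous_on {0..} g"
  shows "abs_continuous_on {0..T} f"
proof -
  have "compact (g ` {0..T})"
    using g by (intro compact_continuous_image) (auto intro: continuous_on_subset)
  then obtain B where B: "B > 0" "\<And>t. t \<in> {0..T} \<Longrightarrow> norm (g t) \<le> B"
    by (metis bounded_pos compact_imp_bounded imageI)
  have "B-lipschitz_on {0..T} f"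
  proof (rule has_vector_derivative_bounded_imp_lipschitz_on)
    show "(f has_vector_derivative g t) (at t within {0..T})" if "t \<in> {0..T}" for t
      by (rule has_vector_derivative_within_subset[OF der]) (use that in auto)
  qed (use B in auto)
  then show ?thesis by (rule lipschitz_on_imp_abs_continuous_on)
qed

text \<open>This turns almost-everywhere solutions into classical ones. The primitive of the
  continuous \<open>g\<close> has derivative \<open>g\<close> everywhere and is absolutely
  continuous; its difference from \<open>f\<close> has derivative zero off a null set and is hence
  constant, so \<open>f\<close> inherits the derivative at every time. In the applications
  \<open>g\<close> is the right-hand side evaluated along the solution itself.\<close>

lemma abs_continuous_on_classical_derivative:
  fixes f g :: "real \<Rightarrow> 'a::euclidean_space"
  assumes ac: "\<And>T. T \<ge> 0 \<Longrightarrow> abs_continuous_on {0..T} f" and g: "continuous_on {0..} g"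
    and ae: "AE t in lebesgue_on {0..}. (f has_vector_derivative g t) (at t within {0..})"
    and "t \<ge> 0"
  shows "(f has_vector_derivative g t) (at t within {0..})"
proof -
  have "AE t in lebesgue. t \<in> {0..} \<longrightarrow> (f has_vector_derivative g t) (at t within {0..})"
    using ae by (subst (asm) AE_restrict_space_iff) auto
  then obtain N where N: "N \<in> null_sets lebesgue"
    and sub: "{t. \<not> (t \<in> {0..} \<longrightarrow> (f has_vector_derivative g t) (at t within {0..}))} \<subseteq> N"
    unfolding eventually_ae_filter by auto
  have fN: "(f has_vector_derivative g t) (at t within {0..})" if "t \<notin> N" "t \<ge> 0" for t
    using sub that by blast
  define h where "h t = integral {0..t} g" for t
  have h: "(h has_vector_derivative g t) (at t within {0..})" if "t \<ge> 0" for t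
    using has_vector_derivative_integral_half_line[OF g that] unfolding h_def .
  have eq: "f T = f 0 + h T" if "T \<ge> 0" for T
  proof -
    have "abs_continuous_on {0..T} h"
      using h g by (rule continuous_derivative_imp_abs_continuous_on)
    then have "abs_continuous_on {0..T} (\<lambda>t. f t - h t)"
      by (intro abs_continuous_on_diff ac that)
    then have "f T - h T = f 0 - h 0"
    proof (rule abs_continuous_on_zero_derivative_eq[OF that])
      show "negligible N" using N by (simp add: negligible_iff_null_sets)
      fix t assume t: "t \<in> {0..T} - N"
      have "((\<lambda>t. f t - h t) has_vector_derivative g t - g t) (at t within {0..})"
        using t by (intro has_vector_derivative_diff fN h) auto
      from has_vector_derivative_within_subset[OF this, of "{0..T}"]
      show "((\<lambda>t. f t - h t) has_vector_derivative 0) (at t within {0..T})"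
        by simp
    qed
    then show ?thesis by (simp add: h_def algebra_simps)
  qed
  have "((\<lambda>t. f 0 + h t) has_vector_derivative g t) (at t within {0..})"
    using has_vector_derivative_add[OF has_vector_derivative_const h[OF \<open>t \<ge> 0\<close>], of "f 0"] by simp
  then show ?thesis
    by (rule has_vector_derivative_transform[rotated 2]) (use \<open>t \<ge> 0\<close> in \<open>auto intro: eq\<close>)
qed

lemma has_vector_derivative_vec:
  fixes f :: "real \<Rightarrow> ('a::real_normed_vector)^'n"
  assumes "\<And>i. ((\<lambda>t. f t $ i) has_vector_derivative f' $ i) (at t within S)"
  shows "(f has_vector_derivative f') (at t within S)"
proof -
  have "((\<lambda>y. ((f y - f t) - (y - t) *\<^sub>R f') /\<^sub>R norm (y - t)) \<longlongrightarrow> 0) (at t within S)"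
  proof (rule vec_tendstoI)
    fix i
    show "((\<lambda>y. (((f y - f t) - (y - t) *\<^sub>R f') /\<^sub>R norm (y - t)) $ i) \<longlongrightarrow> 0 $ i) (at t within S)"
      using assms[of i] by (simp add: has_vector_derivative_def has_derivative_at_within)
  qed
  then show ?thesis
    by (simp add: has_vector_derivative_def has_derivative_at_within bounded_linear_scaleR_left)
qed

lemma continuous_on_half_line_if_abs_continuous:
  fixes f :: "real \<Rightarrow> 'a::metric_space"
  assumes "\<And>T. T \<ge> 0 \<Longrightarrow> abs_continuous_on {0..T} f"
  shows "continuous_on {0..} f"
  unfolding continuous_on_eq_continuous_within
proof
  fix t :: real assume "t \<in> {0..}"
  then have "continuous_on {0..t+1} f"
    using assms[of "t+1"] by (intro abs_continuous_on_imp_continuous_on) (auto simp: is_interval_cc)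
  then have "continuous (at t within {0..t+1}) f"
    using \<open>t \<in> {0..}\<close> by (simp add: continuous_on_eq_continuous_within)
  moreover have "at t within {0..t+1} = at t within {0..}"
    by (rule at_within_nhd[of t "{..<t+1}"]) auto
  ultimately show "continuous (at t within {0..}) f" by simp
qed

section \<open>Global solutions for given masses\<close>

text \<open>
  Picard iteration on \<open>z(t) = e\<^bsup>-kt\<^esup> x(t)\<close> with \<open>k = 2 (L + 1)\<close> is a contraction of the bounded continuous
  functions on the whole half line, so that no gluing of local solutions is needed.
\<close>
lemma lipschitz_ode_global_solution:
  fixes F :: "real \<Rightarrow> 'a::banach \<Rightarrow> 'a"
  assumes cont: "continuous_on ({0..} \<times> UNIV) (\<lambda>(t, y). F t y)"
    and lip: "\<And>t. t \<ge> 0 \<Longrightarrow> L-lipschitz_on UNIV (F t)"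
    and bd: "\<And>t. t \<ge> 0 \<Longrightarrow> norm (F t 0) \<le> K"
  obtains x where "x 0 = x0"
    "\<And>t. t \<ge> 0 \<Longrightarrow> (x has_vector_derivative F t (x t)) (at t within {0..})"
proof -
  have "L \<ge> 0" using lip[of 0] lipschitz_on_nonneg by auto
  have "K \<ge> 0" using bd[of 0] norm_ge_zero order_trans by blast
  \<comment> \<open>The contraction factor will be \<open>L / k\<close>, hence at most 1/2; the
    added 1 keeps \<open>k\<close> positive when \<open>L = 0\<close>.\<close>
  define k where "k = 2 * (L + 1)"
  have "k > 0" using \<open>L \<ge> 0\<close> by (simp add: k_def)
  define G where "G z s = F s (exp (k * s) *\<^sub>R apply_bcontfun z s)" for z s
  have contG: "continuous_on {0..} (G z)" for z
  proof -
    have "continuous_on {0..} (\<lambda>s. (\<lambda>(t, y). F t y) (s, exp (k * s) *\<^sub>R apply_bcontfun z s))"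
      by (rule continuous_on_compose2[OF cont]) (auto intro!: continuous_intros)
    then show ?thesis by (simp add: G_def[abs_def])
  qed
  have intG: "G z integrable_on {0..t}" for z t
    by (rule integrable_continuous_interval) (rule continuous_on_subset[OF contG], auto)
  have exp_int: "((\<lambda>s. c * exp (k * s)) has_integral c * ((exp (k * t) - 1) / k)) {0..t}" if "t \<ge> 0" for c t
  proof -
    have "((\<lambda>s. exp (k * s)) has_integral exp (k * t) / k - exp (k * 0) / k) {0..t}"
      using that \<open>k > 0\<close>
      by (intro fundamental_theorem_of_calculus)
        (auto intro!: derivative_eq_intros simp: has_real_derivative_iff_has_vector_derivative[symmetric])
    from has_integral_mult_right[OF this, of c] show ?thesis
      by (simp add: diff_divide_distrib)
  qed
  \<comment> \<open>The gain of the weighted norm: integrating \<open>exp (k * s)\<close> costs a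
    factor \<open>1 / k\<close>, and the weight \<open>exp (- (k * t))\<close> cancels the growth
    uniformly in \<open>t\<close>. It serves twice, with \<open>c = K + L * norm z\<close> for
    boundedness and with \<open>c = L * dist z w\<close> for contraction.\<close>
  have exp_bound: "norm (exp (- (k * t)) *\<^sub>R integral {0..t} h) \<le> c / k"
    if "t \<ge> 0" "c \<ge> 0" "h integrable_on {0..t}"
      "\<And>s. s \<in> {0..t} \<Longrightarrow> norm (h s) \<le> c * exp (k * s)" for t c and h :: "real \<Rightarrow> 'a"
  proof -
    have "norm (integral {0..t} h) \<le> integral {0..t} (\<lambda>s. c * exp (k * s))"
      using that exp_int[OF \<open>t \<ge> 0\<close>] by (intro integral_norm_bound_integral) auto
    also have "\<dots> = c * ((exp (k * t) - 1) / k)"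
      using exp_int[OF \<open>t \<ge> 0\<close>] by (rule integral_unique)
    also have "\<dots> \<le> c * (exp (k * t) / k)"
      using that \<open>k > 0\<close> by (intro mult_left_mono divide_right_mono) auto
    finally have "exp (- (k * t)) * norm (integral {0..t} h) \<le> exp (- (k * t)) * (c * (exp (k * t) / k))"
      by (intro mult_left_mono) auto
    then show ?thesis by (simp add: exp_minus field_simps)
  qed
  \<comment> \<open>Bounded continuous functions live on the whole line, so the iterate is extended
    to negative times by its value at 0.\<close>
  define P where "P z t = exp (- (k * max 0 t)) *\<^sub>R (x0 + integral {0..max 0 t} (G z))" for z t
  have P_bcontfun: "P z \<in> bcontfun" for z
  proof (rule bcontfun_normI)
    have "continuous_on {0..} (\<lambda>t. integral {0..t} (G z))"
      using has_vector_derivative_integral_half_line[OF contG]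
      by (intro continuous_on_vector_derivative) auto
    then have "continuous_on UNIV (\<lambda>t. integral {0..max 0 t} (G z))"
      by (rule continuous_on_compose2[where f="max 0"]) (auto intro!: continuous_intros)
    then show "continuous_on UNIV (P z)"
      unfolding P_def by (intro continuous_intros)
    show "norm (P z t) \<le> norm x0 + (K + L * norm z) / k" for t
    proof -
      define r where "r = max 0 t"
      have "r \<ge> 0" by (simp add: r_def)
      have "norm (G z s) \<le> (K + L * norm z) * exp (k * s)" if "s \<in> {0..r}" for s
      proof -
        have "s \<ge> 0" using that by simp
        have "norm (G z s) \<le> norm (F s 0) + norm (G z s - F s 0)"
          using norm_triangle_ineq[of "F s 0" "G z s - F s 0"] by simp
        also have "norm (G z s - F s 0) \<le> L * norm (exp (k * s) *\<^sub>R apply_bcontfun z s)"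
          using lipschitz_onD[OF lip[OF \<open>s \<ge> 0\<close>], of "exp (k * s) *\<^sub>R apply_bcontfun z s" 0]
          by (simp add: G_def dist_norm)
        also have "\<dots> \<le> L * (exp (k * s) * norm z)"
          using \<open>L \<ge> 0\<close> norm_bounded[of z s] by (simp add: mult_left_mono)
        also have "norm (F s 0) \<le> K * exp (k * s)"
          using bd[OF \<open>s \<ge> 0\<close>] \<open>K \<ge> 0\<close> \<open>s \<ge> 0\<close> \<open>k > 0\<close> mult_left_mono[of 1 "exp (k * s)" K] by simp
        finally show ?thesis by (simp add: algebra_simps)
      qed
      then have "norm (exp (- (k * r)) *\<^sub>R integral {0..r} (G z)) \<le> (K + L * norm z) / k"
        using \<open>r \<ge> 0\<close> \<open>K \<ge> 0\<close> \<open>L \<ge> 0\<close> intG by (intro exp_bound) auto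
      moreover have "norm (exp (- (k * r)) *\<^sub>R x0) \<le> norm x0"
        using \<open>r \<ge> 0\<close> \<open>k > 0\<close> by (simp add: mult_left_le_one_le)
      ultimately have "norm (exp (- (k * r)) *\<^sub>R x0 + exp (- (k * r)) *\<^sub>R integral {0..r} (G z))
          \<le> norm x0 + (K + L * norm z) / k"
        by (intro norm_triangle_le add_mono) auto
      then show ?thesis unfolding P_def r_def[symmetric] by (simp add: scaleR_add_right)
    qed
  qed
  define \<Phi> where "\<Phi> z = Bcontfun (P z)" for z
  have \<Phi>: "apply_bcontfun (\<Phi> z) = P z" for z
    unfolding \<Phi>_def by (rule Bcontfun_inverse[OF P_bcontfun])
  have "dist (\<Phi> z) (\<Phi> w) \<le> 1 / 2 * dist z w" for z w
  proof (rule dist_bound)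
    fix t :: real
    define r where "r = max 0 t"
    have "r \<ge> 0" by (simp add: r_def)
    have "norm (G z s - G w s) \<le> L * dist z w * exp (k * s)" if "s \<in> {0..r}" for s
    proof -
      have "s \<ge> 0" using that by simp
      have "norm (G z s - G w s) \<le> L * dist (exp (k * s) *\<^sub>R apply_bcontfun z s) (exp (k * s) *\<^sub>R apply_bcontfun w s)"
        using lipschitz_onD[OF lip[OF \<open>s \<ge> 0\<close>]] by (simp add: G_def dist_norm)
      also have "\<dots> \<le> L * (exp (k * s) * dist z w)"
        using \<open>L \<ge> 0\<close> dist_bounded[of z s w]
        by (simp add: dist_norm scaleR_diff_right[symmetric] mult_left_mono)
      finally show ?thesis by (simp add: mult_ac)
    qed
    then have "norm (exp (- (k * r)) *\<^sub>R integral {0..r} (\<lambda>s. G z s - G w s)) \<le> L * dist z w / k"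
      using \<open>r \<ge> 0\<close> \<open>L \<ge> 0\<close> by (intro exp_bound integrable_diff intG) auto
    also have "\<dots> \<le> 1 / 2 * dist z w"
      using \<open>L \<ge> 0\<close> by (simp add: k_def field_simps)
    finally show "dist (apply_bcontfun (\<Phi> z) t) (apply_bcontfun (\<Phi> w) t) \<le> 1 / 2 * dist z w"
      unfolding \<Phi> P_def r_def[symmetric]
      by (simp add: dist_norm scaleR_diff_right[symmetric] integral_diff[OF intG intG])
  qed
  then obtain z where z: "\<Phi> z = z"
    using banach_fix_type[of "1 / 2" \<Phi>] by auto
  \<comment> \<open>Undoing the weight: the integral form of the fixed point is the solution, and
    \<open>x_eq\<close> identifies it with the rescaled \<open>z\<close> on the half line.\<close>
  define x where "x t = x0 + integral {0..t} (G z)" for t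
  have x_eq: "x t = exp (k * t) *\<^sub>R apply_bcontfun z t" if "t \<ge> 0" for t
  proof -
    have "apply_bcontfun z t = P z t" using \<Phi>[of z] z by simp
    then show ?thesis using that by (simp add: P_def x_def exp_minus)
  qed
  show thesis
  proof
    show "x 0 = x0" by (simp add: x_def)
    fix t :: real assume "t \<ge> 0"
    have "(x has_vector_derivative 0 + G z t) (at t within {0..})"
      unfolding x_def
      by (intro has_vector_derivative_add has_vector_derivative_const
          has_vector_derivative_integral_half_line contG \<open>t \<ge> 0\<close>)
    moreover have "G z t = F t (x t)" by (simp add: G_def x_eq[OF \<open>t \<ge> 0\<close>])
    ultimately show "(x has_vector_derivative F t (x t)) (at t within {0..})" by simp
  qed
qed

section \<open>Confinement of trajectories to a ball\<close>

lemma closest_point_cball_0: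
  fixes z :: "'a::euclidean_space"
  assumes "R \<ge> 0" "norm z > R"
  shows "closest_point (cball 0 R) z = (R / norm z) *\<^sub>R z"
proof (rule closest_point_unique[symmetric])
  show "(R / norm z) *\<^sub>R z \<in> cball 0 R" using assms by simp
  have "z - (R / norm z) *\<^sub>R z = (1 - R / norm z) *\<^sub>R z"
    by (simp add: scaleR_diff_left)
  then have "dist z ((R / norm z) *\<^sub>R z) = \<bar>1 - R / norm z\<bar> * norm z"
    unfolding dist_norm by simp
  also have "\<dots> = (1 - R / norm z) * norm z" using assms by (simp add: divide_le_eq)
  also have "\<dots> = norm z - R" using assms by (auto simp: field_simps)
  finally have eq: "dist z ((R / norm z) *\<^sub>R z) = norm z - R" .
  show "\<forall>y\<in>cball 0 R. dist z ((R / norm z) *\<^sub>R z) \<le> dist z y"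
  proof
    fix y :: 'a assume "y \<in> cball 0 R"
    then show "dist z ((R / norm z) *\<^sub>R z) \<le> dist z y"
      using eq norm_triangle_ineq2[of z y] by (simp add: dist_norm)
  qed
qed auto

text \<open>If the norm exceeded \<open>R\<close> at time \<open>t\<close>, take the last earlier
  time \<open>s\<close> at which it did not. On the interval from \<open>s\<close> to
  \<open>t\<close> the trajectory is outside the ball, so its squared norm cannot increase, a
  contradiction. A sign condition strictly outside the ball is therefore enough.\<close>

lemma norm_le_if_inner_derivative_nonpos:
  fixes x :: "real \<Rightarrow> 'a::real_inner"
  assumes der: "\<And>t. t \<ge> 0 \<Longrightarrow> (x has_vector_derivative x' t) (at t within {0..})"
    and "norm (x 0) \<le> R"
    and nonpos: "\<And>t. t \<ge> 0 \<Longrightarrow> norm (x t) > R \<Longrightarrow> x t \<bullet> x' t \<le> 0"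
    and "t \<ge> 0"
  shows "norm (x t) \<le> R"
proof (rule ccontr)
  assume t: "\<not> norm (x t) \<le> R"
  have cont: "continuous_on {0..} x"
    using der by (intro continuous_on_vector_derivative) auto
  have contn: "continuous_on {0..t} (\<lambda>s. norm (x s))"
    by (intro continuous_intros continuous_on_subset[OF cont]) auto
  define A where "A = {s \<in> {0..t}. norm (x s) \<le> R}"
  have "A = {0..t} \<inter> (\<lambda>s. norm (x s)) -` {..R}" by (auto simp: A_def)
  then have "closed A" using continuous_closed_preimage[OF contn] by simp
  moreover have "bounded A"
    unfolding A_def by (rule bounded_subset[OF bounded_closed_interval[of 0 t]]) auto
  ultimately have "compact A" by (simp add: compact_eq_bounded_closed)
  moreover have "0 \<in> A" using assms by (simp add: A_def)
  ultimately obtain s where s: "s \<in> A" "\<And>r. r \<in> A \<Longrightarrow> r \<le> s"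
    using compact_attains_sup[of A] by auto
  then have s': "0 \<le> s" "s \<le> t" "norm (x s) \<le> R" by (auto simp: A_def)
  have gt: "norm (x r) > R" if "s < r" "r \<le> t" for r
    using s(2)[of r] that s' by (fastforce simp: A_def)
  have "(\<lambda>r. x r \<bullet> x r) t \<le> (\<lambda>r. x r \<bullet> x r) s"
  proof (rule DERIV_nonpos_imp_decreasing_open[OF \<open>s \<le> t\<close>])
    show "continuous_on {s..t} (\<lambda>r. x r \<bullet> x r)"
      using s' by (intro continuous_intros continuous_on_subset[OF cont]) auto
    fix r assume r: "s < r" "r < t"
    then have "at r within {0..} = at r"
      using s' by (intro at_within_interior) (auto simp: interior_Ici[of "-1"])
    then have "(x has_vector_derivative x' r) (at r)"
      using der[of r] r s' by simp
    then have "((\<lambda>r. x r \<bullet> x r) has_vector_derivative x r \<bullet> x' r + x' r \<bullet> x r) (at r)"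
      by (intro bounded_bilinear.has_vector_derivative[OF bounded_bilinear_inner])
    moreover have "x r \<bullet> x' r + x' r \<bullet> x r \<le> 0"
      using nonpos[of r] gt[of r] r s' by (simp add: inner_commute)
    ultimately show "\<exists>y. ((\<lambda>r. x r \<bullet> x r) has_real_derivative y) (at r) \<and> y \<le> 0"
      by (auto simp: has_real_derivative_iff_has_vector_derivative)
  qed
  then have "norm (x t) \<le> norm (x s)" by (simp add: norm_le)
  with t s' show False by simp
qed

lemma norm_vec_le_if_norm_nth_le:
  fixes v :: "('a::real_normed_vector)^'n"
  assumes "\<And>i. norm (v $ i) \<le> c"
  shows "norm v \<le> real CARD('n) * c"
proof -
  have "norm v \<le> (\<Sum>i\<in>UNIV. norm (v $ i))"
    unfolding norm_vec_def by (rule L2_set_le_sum) simp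
  also have "\<dots> \<le> (\<Sum>i\<in>(UNIV::'n set). c)"
    by (intro sum_mono assms)
  finally show ?thesis by simp
qed

definition velocity :: "(real \<Rightarrow> real) \<Rightarrow> real \<Rightarrow> real^'n \<Rightarrow> (real^'d)^'n \<Rightarrow> (real^'d)^'n" where
  "velocity a M m x = (\<chi> i. (1 / M) *\<^sub>R (\<Sum>j\<in>UNIV.
      (m $ j * a (norm (x $ i - x $ j))) *\<^sub>R (x $ j - x $ i)))"

text \<open>
  Projecting all positions to the ball of radius \<open>R = norm x0\<close> makes the field globally Lipschitz. An
  agent outside that ball has a velocity pointing inwards, so the solution never leaves
  it and solves the original equation.
\<close>
lemma velocity_global_solution:
  fixes x0 :: "(real^'d)^'n" and m :: "real \<Rightarrow> real^'n"
  assumes a: "\<forall>s\<ge>0. a s \<ge> 0"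
    and lip: "local_lipschitz (UNIV :: real set) UNIV (\<lambda>_ (s :: real^'d). a (norm s) *\<^sub>R s)"
    and "M > 0"
    and contm: "continuous_on {0..} m"
    and m: "\<And>t i. t \<ge> 0 \<Longrightarrow> 0 \<le> m t $ i \<and> m t $ i \<le> B"
  obtains x where "x 0 = x0"
    "\<And>t. t \<ge> 0 \<Longrightarrow> (x has_vector_derivative velocity a M (m t) (x t)) (at t within {0..})"
proof -
  define R where "R = norm x0"
  define g where "g s = a (norm s) *\<^sub>R s" for s :: "real^'d"
  define P where "P = closest_point (cball (0 :: real^'d) R)"
  have "R \<ge> 0" by (simp add: R_def)
  have "B \<ge> 0" using m[of 0 undefined] by simp
  \<comment> \<open>The field is autonomous; the one-point time set provides the compact time
    domain. The radius is \<open>2 * R\<close> because \<open>g\<close> is applied to differences of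
    two points of the ball of radius \<open>R\<close>.\<close>
  have "\<exists>L. \<forall>t\<in>{0::real}. L-lipschitz_on (cball 0 (2 * R)) g"
  proof -
    obtain L where "\<And>t. t \<in> {0::real} \<Longrightarrow> L-lipschitz_on (cball 0 (2 * R)) (\<lambda>s :: real^'d. a (norm s) *\<^sub>R s)"
      by (rule local_lipschitz_compact_implies_lipschitz
          [OF local_lipschitz_subset[OF lip, of "{0}" "cball 0 (2 * R)"] compact_cball])
        auto
    then show ?thesis by (auto simp: g_def[abs_def])
  qed
  then obtain L where L: "L-lipschitz_on (cball 0 (2 * R)) g" by auto
  have "L \<ge> 0" using L lipschitz_on_nonneg by blast
  have P_norm: "norm (P z) \<le> R" for z
    using closest_point_in_set[of "cball (0 :: real^'d) R" z] \<open>R \<ge> 0\<close> by (simp add: P_def)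
  have P_lip: "norm (P y - P z) \<le> norm (y - z)" for y z
    using closest_point_lipschitz[of "cball (0 :: real^'d) R" y z] \<open>R \<ge> 0\<close> by (simp add: P_def dist_norm)
  have P_diff: "P y - P z \<in> cball 0 (2 * R)" for y z
    using norm_triangle_ineq4[of "P y" "P z"] P_norm[of y] P_norm[of z] by simp
  define F where "F t y = (\<chi> i. (1 / M) *\<^sub>R (\<Sum>j\<in>UNIV. m t $ j *\<^sub>R g (P (y $ j) - P (y $ i))))"
    for t and y :: "(real^'d)^'n"
  have "continuous_on UNIV P"
    unfolding P_def using \<open>R \<ge> 0\<close> by (intro continuous_on_closest_point) auto
  then have contP: "continuous_on S (\<lambda>p. P (f p))" if "continuous_on S f" for S and f :: "real \<times> ((real^'d)^'n) \<Rightarrow> _"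
    using that by (rule continuous_on_compose2) auto
  have contg: "continuous_on S (\<lambda>p. g (P (f p) - P (h p)))" if "continuous_on S f" "continuous_on S h"
    for S and f h :: "real \<times> ((real^'d)^'n) \<Rightarrow> _"
    by (rule continuous_on_compose2[OF lipschitz_on_continuous_on[OF L]])
      (use P_diff in \<open>auto intro!: continuous_intros contP that simp del: mem_cball_0\<close>)
  have cont: "continuous_on ({0..} \<times> UNIV) (\<lambda>(t, y). F t y)"
  proof -
    have "continuous_on ({0..} \<times> UNIV) (\<lambda>p :: real \<times> ((real^'d)^'n). m (fst p))"
      by (rule continuous_on_compose2[OF contm]) (auto intro!: continuous_intros)
    then show ?thesis
      unfolding F_def case_prod_beta by (intro continuous_intros contg)
  qed
  \<comment> \<open>The outer cardinality passes from components to the whole vector, the inner one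
    counts the summands, \<open>B\<close> bounds the masses, and the 2 arises because both agents of
    a pair move.\<close>
  have F_lip: "(real CARD('n) * ((1 / M) * (real CARD('n) * (B * (L * 2)))))-lipschitz_on UNIV (F t)" if "t \<ge> 0" for t
  proof (rule lipschitz_onI)
    fix y z :: "(real^'d)^'n"
    have "norm ((F t y - F t z) $ i) \<le> (1 / M) * (real CARD('n) * (B * (L * (2 * norm (y - z)))))" for i
    proof -
      have "norm (m t $ j *\<^sub>R (g (P (y $ j) - P (y $ i)) - g (P (z $ j) - P (z $ i))))
          \<le> B * (L * (2 * norm (y - z)))" for j
      proof -
        have "norm (g (P (y $ j) - P (y $ i)) - g (P (z $ j) - P (z $ i)))
            \<le> L * norm ((P (y $ j) - P (y $ i)) - (P (z $ j) - P (z $ i)))"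
          using lipschitz_onD[OF L P_diff P_diff] by (simp add: dist_norm)
        also have "\<dots> = L * norm ((P (y $ j) - P (z $ j)) - (P (y $ i) - P (z $ i)))"
          by (simp add: algebra_simps)
        also have "\<dots> \<le> L * (norm (y $ j - z $ j) + norm (y $ i - z $ i))"
          using \<open>L \<ge> 0\<close> P_lip[of "y $ j" "z $ j"] P_lip[of "y $ i" "z $ i"]
          norm_triangle_ineq4[of "P (y $ j) - P (z $ j)" "P (y $ i) - P (z $ i)"]
          by (intro mult_left_mono) linarith+
        also have "\<dots> \<le> L * (2 * norm (y - z))"
          using \<open>L \<ge> 0\<close> Finite_Cartesian_Product.norm_nth_le[of "y - z" i] Finite_Cartesian_Product.norm_nth_le[of "y - z" j] by (intro mult_left_mono) auto
        finally show ?thesis using m[OF \<open>t \<ge> 0\<close>, of j] \<open>B \<ge> 0\<close> by (auto intro!: mult_mono)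
      qed
      then have "norm (\<Sum>j\<in>UNIV. m t $ j *\<^sub>R (g (P (y $ j) - P (y $ i)) - g (P (z $ j) - P (z $ i))))
          \<le> real CARD('n) * (B * (L * (2 * norm (y - z))))"
        by (intro sum_norm_bound)
      then have "(1 / M) * norm (\<Sum>j\<in>UNIV. m t $ j *\<^sub>R (g (P (y $ j) - P (y $ i)) - g (P (z $ j) - P (z $ i))))
          \<le> (1 / M) * (real CARD('n) * (B * (L * (2 * norm (y - z)))))"
        using \<open>M > 0\<close> by (intro mult_left_mono) auto
      then show ?thesis
        using \<open>M > 0\<close> by (simp add: F_def scaleR_diff_right[symmetric] sum_subtractf[symmetric] del: sum_subtractf)
    qed
    then have "norm (F t y - F t z) \<le> real CARD('n) * ((1 / M) * (real CARD('n) * (B * (L * (2 * norm (y - z))))))"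
      by (rule norm_vec_le_if_norm_nth_le)
    then show "dist (F t y) (F t z) \<le> real CARD('n) * ((1 / M) * (real CARD('n) * (B * (L * 2)))) * dist y z"
      by (simp add: dist_norm mult_ac)
  qed (use \<open>L \<ge> 0\<close> \<open>B \<ge> 0\<close> \<open>M > 0\<close> in simp)
  have "F t 0 = 0" for t by (simp add: F_def g_def vec_eq_iff)
  then have F0: "norm (F t 0) \<le> 0" for t by simp
  obtain x where x: "x 0 = x0" "\<And>t. t \<ge> 0 \<Longrightarrow> (x has_vector_derivative F t (x t)) (at t within {0..})"
    using lipschitz_ode_global_solution[OF cont F_lip F0] by metis
  have inv: "norm (x t $ i) \<le> R" if "t \<ge> 0" for t i
  proof (rule norm_le_if_inner_derivative_nonpos[of "\<lambda>t. x t $ i" "\<lambda>t. F t (x t) $ i", OF _ _ _ that])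
    show "((\<lambda>t. x t $ i) has_vector_derivative F t (x t) $ i) (at t within {0..})" if "t \<ge> 0" for t
      using x(2)[OF that] by (rule bounded_linear.has_vector_derivative[OF bounded_linear_vec_nth])
    show "norm (x 0 $ i) \<le> R" by (simp add: x R_def Finite_Cartesian_Product.norm_nth_le)
    fix t :: real assume "t \<ge> 0" and gt: "norm (x t $ i) > R"
    \<comment> \<open>Outside the ball, \<open>P (x t $ i)\<close> is the radial point of length
      \<open>R\<close>, so by Cauchy-Schwarz it maximises the inner product with
      \<open>x t $ i\<close> over the ball. No other projected agent can pull outwards.\<close>
    have "x t $ i \<bullet> (P (x t $ j) - P (x t $ i)) \<le> 0" for j
    proof -
      have "x t $ i \<bullet> P (x t $ j) \<le> norm (x t $ i) * R"
        using norm_cauchy_schwarz[of "x t $ i" "P (x t $ j)"] P_norm[of "x t $ j"]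
        by (meson mult_left_mono norm_ge_zero order_trans)
      also have "\<dots> = x t $ i \<bullet> P (x t $ i)"
        using gt \<open>R \<ge> 0\<close> unfolding P_def
        by (subst closest_point_cball_0) (auto simp: dot_square_norm power2_eq_square)
      finally show ?thesis by (simp add: inner_diff_right)
    qed
    then show "x t $ i \<bullet> F t (x t) $ i \<le> 0"
      using a m[OF \<open>t \<ge> 0\<close>] \<open>M > 0\<close>
      by (auto simp: F_def g_def inner_sum_right intro!: mult_nonneg_nonpos divide_nonpos_pos sum_nonpos)
  qed
  have "F t (x t) = velocity a M (m t) (x t)" if "t \<ge> 0" for t
  proof -
    have "P (x t $ i) = x t $ i" for i
      unfolding P_def using inv[OF that] by (intro closest_point_self) simp
    then show ?thesis by (simp add: F_def velocity_def g_def norm_minus_commute)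
  qed
  with x(2) show thesis by (intro that[of x] x(1)) simp
qed

section \<open>Estimates for the barycenter\<close>

text \<open>A continuation argument: the speed bound is available only within distance
  \<open>r\<close> of the start. At the first time \<open>s\<close> at which this distance is
  reached, the bound gives \<open>r \<le> K * s \<le> K * T\<close>, contradicting
  \<open>K * T < r\<close>.\<close>

lemma norm_diff_le_while_derivative_bounded:
  fixes x :: "real \<Rightarrow> 'a::real_normed_vector"
  assumes der: "\<And>t. t \<ge> 0 \<Longrightarrow> (x has_vector_derivative x' t) (at t within {0..})"
    and K: "\<And>t. t \<ge> 0 \<Longrightarrow> norm (x t - x 0) \<le> r \<Longrightarrow> norm (x' t) \<le> K"
    and "K \<ge> 0" "T \<ge> 0" "K * T < r"
  shows "norm (x T - x 0) \<le> K * T"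
proof -
  have cont: "continuous_on {0..} x"
    using der by (intro continuous_on_vector_derivative) auto
  then have contn: "continuous_on {0..s} (\<lambda>s. norm (x s - x 0))" for s
    by (intro continuous_intros continuous_on_subset[OF cont]) auto
  have "r > 0" using assms by (smt (verit) mult_nonneg_nonneg)
  have bound: "norm (x t - x 0) \<le> K * t" if "t \<ge> 0" "\<And>s. s \<in> {0..t} \<Longrightarrow> norm (x s - x 0) \<le> r" for t
  proof -
    have "K-lipschitz_on {0..t} x"
    proof (rule has_vector_derivative_bounded_imp_lipschitz_on)
      show "(x has_vector_derivative x' s) (at s within {0..t})" if "s \<in> {0..t}" for s
        by (rule has_vector_derivative_within_subset[OF der]) (use that in auto)
    qed (use K that \<open>K \<ge> 0\<close> in auto)
    from lipschitz_onD[OF this, of t 0] \<open>t \<ge> 0\<close> show ?thesis by (simp add: dist_norm)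
  qed
  have "norm (x t - x 0) \<le> r" if t: "t \<in> {0..T}" for t
  proof (rule ccontr)
    assume "\<not> norm (x t - x 0) \<le> r"
    define A where "A = {s \<in> {0..t}. norm (x s - x 0) = r}"
    have hit: "\<exists>s\<in>{0..u}. norm (x s - x 0) = r" if "u \<ge> 0" "norm (x u - x 0) > r" for u
      using IVT'[of "\<lambda>s. norm (x s - x 0)" 0 r u] contn[of u] that \<open>r > 0\<close> by auto
    have "closed A"
      unfolding A_def using continuous_closed_preimage_constant[OF contn closed_atLeastAtMost] by simp
    moreover have "bounded A" unfolding A_def by (rule bounded_subset[OF bounded_closed_interval[of 0 t]]) auto
    ultimately have "compact A" by (simp add: compact_eq_bounded_closed)
    moreover have "A \<noteq> {}" using hit[of t] t \<open>\<not> norm (x t - x 0) \<le> r\<close> by (auto simp: A_def)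
    ultimately obtain s where s: "s \<in> A" "\<And>u. u \<in> A \<Longrightarrow> s \<le> u"
      using compact_attains_inf[of A] by auto
    then have s': "0 \<le> s" "s \<le> t" "norm (x s - x 0) = r" by (auto simp: A_def)
    \<comment> \<open>An excursion beyond \<open>r\<close> before time \<open>s\<close> would, by
      the intermediate value theorem, have hit \<open>r\<close> even earlier, against the minimality
      of \<open>s\<close>.\<close>
    have "norm (x u - x 0) \<le> r" if u: "u \<in> {0..s}" for u
    proof (rule ccontr)
      assume "\<not> norm (x u - x 0) \<le> r"
      then obtain v where "v \<in> {0..u}" "norm (x v - x 0) = r" using hit[of u] u by auto
      moreover from this have "s \<le> v" using s(2)[of v] u s' by (auto simp: A_def)
      ultimately have "v = u" using u by auto
      with \<open>norm (x v - x 0) = r\<close> \<open>\<not> norm (x u - x 0) \<le> r\<close> show False by simp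
    qed
    then have "r \<le> K * s" using bound[OF \<open>0 \<le> s\<close>] s' by simp
    also have "\<dots> \<le> K * T" using s' t \<open>K \<ge> 0\<close> by (intro mult_left_mono) auto
    finally show False using \<open>K * T < r\<close> by simp
  qed
  then show ?thesis using bound[OF \<open>T \<ge> 0\<close>] by simp
qed

text \<open>Positive masses stay positive under a bounded control, so a zero weight could not be
  attained and its logarithm would be meaningless; being interior is what makes all weights
  positive.\<close>

lemma interior_convex_hull_positive_weights:
  fixes f :: "'n::finite \<Rightarrow> 'a::euclidean_space"
  assumes "p \<in> interior (convex hull (range f))"
  obtains w where "\<And>i. w i > 0" "(\<Sum>i\<in>UNIV. w i) = (1::real)" "(\<Sum>i\<in>UNIV. w i *\<^sub>R f i) = p"
proof -
  \<comment> \<open>The combinations are indexed by agents rather than by points, as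
    \<open>f\<close> may take a value several times.\<close>
  define S where "S = {(\<Sum>i\<in>UNIV. w i *\<^sub>R f i) | w. (\<forall>i. w i \<ge> (0::real)) \<and> (\<Sum>i\<in>UNIV. w i) = 1}"
  have "convex S"
  proof (rule convexI)
    fix y z and u v :: real assume "y \<in> S" "z \<in> S" and uv: "u \<ge> 0" "v \<ge> 0" "u + v = 1"
    then obtain w w' where w: "y = (\<Sum>i\<in>UNIV. w i *\<^sub>R f i)" "\<forall>i. w i \<ge> 0" "(\<Sum>i\<in>UNIV. w i) = 1"
      and w': "z = (\<Sum>i\<in>UNIV. w' i *\<^sub>R f i)" "\<forall>i. w' i \<ge> 0" "(\<Sum>i\<in>UNIV. w' i) = 1"
      by (auto simp: S_def)
    have "u *\<^sub>R y + v *\<^sub>R z = (\<Sum>i\<in>UNIV. (u * w i + v * w' i) *\<^sub>R f i)"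
      by (simp add: w w' scaleR_sum_right scaleR_add_left sum.distrib)
    moreover have "\<forall>i. u * w i + v * w' i \<ge> 0" using uv w w' by simp
    moreover have "(\<Sum>i\<in>UNIV. u * w i + v * w' i) = 1"
      using w w' uv by (simp add: sum.distrib sum_distrib_left[symmetric])
    ultimately show "u *\<^sub>R y + v *\<^sub>R z \<in> S"
      unfolding S_def by (intro CollectI exI[of _ "\<lambda>i. u * w i + v * w' i"] conjI)
  qed
  moreover have "range f \<subseteq> S"
  proof clarify
    fix k
    show "f k \<in> S"
      unfolding S_def by (intro CollectI exI[of _ "\<lambda>i. if i = k then 1 else 0"])
        (simp add: if_distrib[of "\<lambda>c. c *\<^sub>R _"] cong: if_cong)
  qed
  ultimately have hull: "convex hull (range f) \<subseteq> S" by (intro hull_minimal)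
  define n where "n = real CARD('n)"
  have "n > 0" by (simp add: n_def)
  define c where "c = (\<Sum>i\<in>UNIV. (1 / n) *\<^sub>R f i)"
  \<comment> \<open>Extend the segment from the centroid \<open>c\<close> to \<open>p\<close> slightly beyond \<open>p\<close>, staying in the hull: then \<open>p\<close> is a
    proper convex combination of \<open>c\<close>, whose weights are positive, and the new end point.\<close>
  obtain e where e: "e > 0" "ball p e \<subseteq> convex hull (range f)"
    using assms mem_interior by blast
  \<comment> \<open>The displacement \<open>s * norm (p - c)\<close> is at most
    \<open>e / 2\<close>; the added 1 covers \<open>p = c\<close>.\<close>
  define s where "s = e / (2 * (norm (p - c) + 1))"
  have "s > 0" using \<open>e > 0\<close> by (simp add: s_def add_nonneg_pos)
  have "s * norm (p - c) \<le> s * (norm (p - c) + 1)" using \<open>s > 0\<close> by simp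
  also have "\<dots> = e / 2" proof -
    have "norm (p - c) + 1 \<noteq> 0" by (smt (verit) norm_ge_zero)
    then show ?thesis unfolding s_def using \<open>e > 0\<close> by (simp add: divide_simps)
  qed
  also have "\<dots> < e" using \<open>e > 0\<close> by simp
  finally have "p + s *\<^sub>R (p - c) \<in> ball p e" using \<open>s > 0\<close> by (simp add: dist_norm)
  then have "p + s *\<^sub>R (p - c) \<in> S" using e hull by blast
  then obtain w where w: "p + s *\<^sub>R (p - c) = (\<Sum>i\<in>UNIV. w i *\<^sub>R f i)" "\<And>i. w i \<ge> 0" "(\<Sum>i\<in>UNIV. w i) = 1"
    by (auto simp: S_def)
  show thesis
  proof (rule that[of "\<lambda>i. (w i + s / n) / (1 + s)"])
    show "(w i + s / n) / (1 + s) > 0" for i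
      using w(2)[of i] \<open>s > 0\<close> \<open>n > 0\<close> by (simp add: add_nonneg_pos)
    show "(\<Sum>i\<in>UNIV. (w i + s / n) / (1 + s)) = 1"
      using w(3) \<open>s > 0\<close> \<open>n > 0\<close> by (simp add: sum_divide_distrib[symmetric] sum.distrib n_def)
    have "(\<Sum>i\<in>UNIV. ((w i + s / n) / (1 + s)) *\<^sub>R f i)
        = (1 / (1 + s)) *\<^sub>R ((\<Sum>i\<in>UNIV. w i *\<^sub>R f i) + s *\<^sub>R c)"
      by (simp add: c_def scaleR_sum_right sum.distrib[symmetric] scaleR_add_left[symmetric] mult.commute)
    also have "\<dots> = (1 / (1 + s)) *\<^sub>R ((1 + s) *\<^sub>R p)"
      unfolding w(1)[symmetric] by (simp add: algebra_simps)
    also have "\<dots> = p" using \<open>s > 0\<close> by simp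
    finally show "(\<Sum>i\<in>UNIV. ((w i + s / n) / (1 + s)) *\<^sub>R f i) = p" .
  qed
qed

section \<open>The controlled system\<close>

lemma continuous_on_velocity:
  assumes "continuous_on {0..} a" "continuous_on S m" "continuous_on S x"
  shows "continuous_on S (\<lambda>t. velocity a M (m t) (x t))"
proof -
  have nth: "continuous_on S (\<lambda>t. x t $ i)" for i
    using assms(3) by (intro continuous_intros)
  have "continuous_on S (\<lambda>t. a (norm (x t $ i - x t $ j)))" for i j
    by (rule continuous_on_compose2[OF assms(1)]) (auto intro!: continuous_intros nth)
  then show ?thesis
    unfolding velocity_def by (intro continuous_intros nth assms(2))
qed

lemma abs_continuous_on_vec_nth:
  "abs_continuous_on S f \<Longrightarrow> abs_continuous_on S (\<lambda>t. f t $ i)"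
  unfolding abs_continuous_on_def
proof (intro allI impI, goal_cases)
  case (1 e)
  then obtain d where d: "d > 0" "\<forall>D :: (real \<times> real) set. finite D \<longrightarrow>
      (\<forall>(p, q)\<in>D. p < q \<and> {p..q} \<subseteq> S) \<longrightarrow> disjoint_family_on (\<lambda>(p, q). {p<..<q}) D \<longrightarrow>
      (\<Sum>(p, q)\<in>D. q - p) < d \<longrightarrow> (\<Sum>(p, q)\<in>D. dist (f p) (f q)) < e"
    by blast
  show ?case
  proof (intro exI[of _ d] conjI allI impI)
    fix D :: "(real \<times> real) set"
    assume D: "finite D" "\<forall>(p, q)\<in>D. p < q \<and> {p..q} \<subseteq> S"
      "disjoint_family_on (\<lambda>(p, q). {p<..<q}) D" "(\<Sum>(p, q)\<in>D. q - p) < d"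
    have "(\<Sum>(p, q)\<in>D. dist (f p $ i) (f q $ i)) \<le> (\<Sum>(p, q)\<in>D. dist (f p) (f q))"
      by (rule sum_mono) (auto intro: dist_vec_nth_le)
    also have "\<dots> < e" using d D by blast
    finally show "(\<Sum>(p, q)\<in>D. dist (f p $ i) (f q $ i)) < e" .
  qed (use d in auto)
qed

lemma exponential_solution_unique:
  fixes y :: "real \<Rightarrow> real"
  assumes "\<And>t. t \<ge> 0 \<Longrightarrow> (y has_real_derivative y t * c) (at t within {0..})" "t \<ge> 0"
  shows "y t = y 0 * exp (c * t)"
proof -
  have "((\<lambda>t. y t * exp (- (c * t))) has_derivative (\<lambda>h. 0)) (at s within {0..})" if "s \<in> {0..}" for s
  proof -
    have "((\<lambda>t. y t * exp (- (c * t))) has_real_derivative 0) (at s within {0..})"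
      using that by (auto intro!: derivative_eq_intros assms(1))
    then show ?thesis by (simp add: has_field_derivative_def mult_zero_left[abs_def])
  qed
  from has_derivative_zero_unique[OF convex_real_interval(1) this, of t 0] \<open>t \<ge> 0\<close>
  show ?thesis by (simp add: exp_minus field_simps)
qed

text \<open>The mass equations do not involve the positions, and under a constant control their
  right-hand sides are continuous. Each mass of an arbitrary solution is therefore a classical
  solution of a scalar linear equation.\<close>

lemma controlled_solution_const_masses:
  assumes sol: "controlled_solution a M x0 m0 (\<lambda>_. c) x m" and "t \<ge> 0"
  shows "m t $ i = m0 $ i * exp (c $ i * t)"
proof -
  have ac: "abs_continuous_on {0..T} (\<lambda>t. m t $ i)" if "T \<ge> 0" for T
    using sol that by (intro abs_continuous_on_vec_nth) (simp add: controlled_solution_def)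
  have ae: "AE t in lebesgue_on {0..}. ((\<lambda>t. m t $ i) has_vector_derivative m t $ i * c $ i) (at t within {0..})"
  proof -
    have "AE t in lebesgue_on {0..}. \<forall>i. ((\<lambda>s. x s $ i) has_vector_derivative
          (1 / M) *\<^sub>R (\<Sum>j\<in>UNIV. (m t $ j * a (norm (x t $ i - x t $ j))) *\<^sub>R (x t $ j - x t $ i)))
         (at t within {0..}) \<and>
       ((\<lambda>s. m s $ i) has_real_derivative m t $ i * c $ i) (at t within {0..})"
      using sol by (simp add: controlled_solution_def)
    then show ?thesis
      by eventually_elim (simp add: has_real_derivative_iff_has_vector_derivative)
  qed
  have "continuous_on {0..} (\<lambda>t. m t $ i * c $ i)"
    using continuous_on_half_line_if_abs_continuous[OF ac] by (rule continuous_on_mult_right)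
  then have "((\<lambda>t. m t $ i) has_vector_derivative m t $ i * c $ i) (at t within {0..})" if "t \<ge> 0" for t
    using abs_continuous_on_classical_derivative[OF ac _ ae that] by blast
  then have "m t $ i = m 0 $ i * exp (c $ i * t)"
    by (intro exponential_solution_unique \<open>t \<ge> 0\<close>)
      (simp add: has_real_derivative_iff_has_vector_derivative)
  then show ?thesis using sol by (simp add: controlled_solution_def)
qed

text \<open>The control acts on the positions only through the masses, which are continuous, so the
  velocity along a solution is continuous for every \<open>u\<close>.\<close>

lemma controlled_solution_positions:
  assumes sol: "controlled_solution a M x0 m0 u x m" and a: "continuous_on {0..} a" and "t \<ge> 0"
  shows "(x has_vector_derivative velocity a M (m t) (x t)) (at t within {0..})"
proof -
  have ac: "abs_continuous_on {0..T} x" "abs_continuous_on {0..T} m" if "T \<ge> 0" for T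
    using sol that by (simp_all add: controlled_solution_def)
  have "AE t in lebesgue_on {0..}. \<forall>i. ((\<lambda>s. x s $ i) has_vector_derivative
        (1 / M) *\<^sub>R (\<Sum>j\<in>UNIV. (m t $ j * a (norm (x t $ i - x t $ j))) *\<^sub>R (x t $ j - x t $ i)))
       (at t within {0..}) \<and>
     ((\<lambda>s. m s $ i) has_real_derivative m t $ i * u t $ i) (at t within {0..})"
    using sol by (simp add: controlled_solution_def)
  then have ae: "AE t in lebesgue_on {0..}. (x has_vector_derivative velocity a M (m t) (x t)) (at t within {0..})"
    by eventually_elim (rule has_vector_derivative_vec, simp add: velocity_def)
  have "continuous_on {0..} (\<lambda>t. velocity a M (m t) (x t))"
    using ac by (intro continuous_on_velocity a continuous_on_half_line_if_abs_continuous)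
  then show ?thesis
    using abs_continuous_on_classical_derivative[OF ac(1) _ ae \<open>t \<ge> 0\<close>] by blast
qed

text \<open>The exponential masses are written down first and enter the position equation as given
  coefficients. Nonpositive rates keep them below \<open>B\<close> on the whole half line, as
  \<open>velocity_global_solution\<close> requires.\<close>

lemma controlled_solution_const_exists:
  fixes x0 :: "(real^'d)^'n" and m0 c :: "real^'n"
  assumes a: "continuous_on {0..} a" "\<forall>s\<ge>0. a s \<ge> 0"
    and lip: "local_lipschitz (UNIV :: real set) UNIV (\<lambda>_ (s :: real^'d). a (norm s) *\<^sub>R s)"
    and "M > 0" and m0: "\<And>i. 0 \<le> m0 $ i \<and> m0 $ i \<le> B" and c: "\<And>i. c $ i \<le> 0"
  shows "\<exists>x m. controlled_solution a M x0 m0 (\<lambda>_. c) x m"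
proof -
  define m where "m t = (\<chi> i. m0 $ i * exp (c $ i * t))" for t
  have contm: "continuous_on {0..} m"
    unfolding m_def by (intro continuous_intros)
  have bound: "0 \<le> m t $ i \<and> m t $ i \<le> B" if "t \<ge> 0" for t i
  proof -
    have "exp (c $ i * t) \<le> 1" using c[of i] that by (simp add: mult_nonpos_nonneg)
    then have "m0 $ i * exp (c $ i * t) \<le> m0 $ i" using m0[of i] by (simp add: mult_left_le)
    then show ?thesis using m0[of i] by (simp add: m_def)
  qed
  obtain x where x: "x 0 = x0"
    "\<And>t. t \<ge> 0 \<Longrightarrow> (x has_vector_derivative velocity a M (m t) (x t)) (at t within {0..})"
    using velocity_global_solution[OF a(2) lip \<open>M > 0\<close> contm bound, of x0] by metis
  have contx: "continuous_on {0..} x"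
    using x(2) by (intro continuous_on_vector_derivative) auto
  have dm: "((\<lambda>s. m s $ i) has_real_derivative m t $ i * c $ i) (at t within {0..})" for t i
    unfolding m_def by (auto intro!: derivative_eq_intros)
  have dmv: "(m has_vector_derivative (\<chi> i. m t $ i * c $ i)) (at t within {0..})" for t
    by (rule has_vector_derivative_vec) (use dm in \<open>simp add: has_real_derivative_iff_has_vector_derivative\<close>)
  have "controlled_solution a M x0 m0 (\<lambda>_. c) x m"
    unfolding controlled_solution_def
  proof (intro conjI allI impI AE_I2)
    show "x 0 = x0" by fact
    show "m 0 = m0" by (simp add: m_def vec_eq_iff)
    show "abs_continuous_on {0..T} x" for T
      using x(2) continuous_on_velocity[OF a(1) contm contx] by (rule continuous_derivative_imp_abs_continuous_on)
    show "abs_continuous_on {0..T} m" for T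
      by (rule continuous_derivative_imp_abs_continuous_on[OF dmv]) (intro continuous_intros contm)
    fix t i assume "t \<in> space (lebesgue_on {0::real..})"
    then have "t \<ge> 0" by simp
    from bounded_linear.has_vector_derivative[OF bounded_linear_vec_nth x(2)[OF this], of i]
    show "((\<lambda>s. x s $ i) has_vector_derivative
        (1 / M) *\<^sub>R (\<Sum>j\<in>UNIV. (m t $ j * a (norm (x t $ i - x t $ j))) *\<^sub>R (x t $ j - x t $ i)))
       (at t within {0..})"
      by (simp add: velocity_def)
    show "((\<lambda>s. m s $ i) has_real_derivative m t $ i * c $ i) (at t within {0..})" by (rule dm)
  qed
  then show ?thesis by blast
qed

text \<open>The point is the uniformity of \<open>K\<close> over all masses in the box: it can be
  fixed before \<tau> and before the rates, which depend on \<tau>.\<close>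

lemma velocity_bounded_near:
  fixes x0 :: "(real^'d)^'n"
  assumes a: "continuous_on {0..} a" and "M > 0"
  obtains K where "K > 0" "\<And>m x. (\<And>i. 0 \<le> m $ i \<and> m $ i \<le> M) \<Longrightarrow> norm (x - x0) \<le> 1 \<Longrightarrow>
    norm (velocity a M m x) \<le> K"
proof -
  \<comment> \<open>Within distance 1 of \<open>x0\<close> each agent has norm at most
    \<open>norm x0 + 1\<close>, so \<open>D\<close> bounds all mutual distances.\<close>
  define D where "D = 2 * (norm x0 + 1)"
  have "continuous_on {0..D} (\<lambda>s. a s * s)"
    by (intro continuous_intros continuous_on_subset[OF a]) auto
  then have "bounded ((\<lambda>s. a s * s) ` {0..D})"
    by (intro compact_imp_bounded compact_continuous_image) auto
  then obtain G where "G > 0" and G: "\<And>s. s \<in> {0..D} \<Longrightarrow> \<bar>a s * s\<bar> \<le> G"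
    unfolding bounded_pos by auto
  define K where "K = real CARD('n) * ((1 / M) * (real CARD('n) * (M * G)))"
  show thesis
  proof
    show "K > 0" using \<open>M > 0\<close> \<open>G > 0\<close> by (simp add: K_def)
    fix m :: "real^'n" and x :: "(real^'d)^'n"
    assume m: "\<And>i. 0 \<le> m $ i \<and> m $ i \<le> M" and x: "norm (x - x0) \<le> 1"
    have "norm x \<le> norm x0 + 1" using x norm_triangle_ineq2[of x x0] by simp
    then have nth: "norm (x $ i) \<le> norm x0 + 1" for i using Finite_Cartesian_Product.norm_nth_le[of x i] by linarith
    have "norm (velocity a M m x $ i) \<le> (1 / M) * (real CARD('n) * (M * G))" for i
    proof -
      have "norm ((m $ j * a (norm (x $ i - x $ j))) *\<^sub>R (x $ j - x $ i)) \<le> M * G" for j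
      proof -
        have "norm (x $ i - x $ j) \<le> D"
          using norm_triangle_ineq4[of "x $ i" "x $ j"] nth[of i] nth[of j] by (simp add: D_def)
        then have "\<bar>a (norm (x $ i - x $ j)) * norm (x $ i - x $ j)\<bar> \<le> G" by (intro G) simp
        then have "\<bar>m $ j\<bar> * \<bar>a (norm (x $ i - x $ j)) * norm (x $ i - x $ j)\<bar> \<le> M * G"
          using m[of j] \<open>M > 0\<close> by (intro mult_mono) auto
        then show ?thesis by (simp add: abs_mult norm_minus_commute mult_ac)
      qed
      then have "norm (\<Sum>j\<in>UNIV. (m $ j * a (norm (x $ i - x $ j))) *\<^sub>R (x $ j - x $ i)) \<le> real CARD('n) * (M * G)"
        by (intro sum_norm_bound)
      then have "(1 / M) * norm (\<Sum>j\<in>UNIV. (m $ j * a (norm (x $ i - x $ j))) *\<^sub>R (x $ j - x $ i))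
          \<le> (1 / M) * (real CARD('n) * (M * G))"
        using \<open>M > 0\<close> by (intro mult_left_mono) auto
      then show ?thesis using \<open>M > 0\<close> by (simp add: velocity_def)
    qed
    then show "norm (velocity a M m x) \<le> K" unfolding K_def by (rule norm_vec_le_if_norm_nth_le)
  qed
qed

section \<open>Choice of the control and steering of the barycenter\<close>

theorem theorem3p1:
  fixes a :: "real \<Rightarrow> real" and M :: real
    and x0 :: "(real^'d)^'n" and m0 :: "real^'n" and xstar :: "real^'d"
  assumes "continuous_on {0..} a"
    and "\<forall>s\<ge>0. a s \<ge> 0"
    and "\<forall>s>0. a s > 0"
    and "local_lipschitz (UNIV :: real set) UNIV (\<lambda>_ (s :: real^'d). a (norm s) *\<^sub>R s)"
    and "M > 0"
    and "\<forall>i. 0 < m0 $ i \<and> m0 $ i < M"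
    and "(\<Sum>i\<in>UNIV. m0 $ i) = M"
    and "xstar \<in> interior (convex hull (range (\<lambda>i. x0 $ i)))"
  shows "\<forall>\<epsilon>>0. \<exists>\<alpha>>0. \<exists>t\<^sub>\<epsilon>\<ge>0. \<exists>u :: real \<Rightarrow> real^'n.
      u \<in> borel_measurable (lebesgue_on {0..}) \<and>
      (\<forall>t\<ge>0. \<forall>i. \<bar>u t $ i\<bar> \<le> \<alpha>) \<and>
      (\<exists>x m. controlled_solution a M x0 m0 u x m) \<and>
      (\<forall>x m. controlled_solution a M x0 m0 u x m \<longrightarrow>
         norm (barycenter (m t\<^sub>\<epsilon>) (x t\<^sub>\<epsilon>) - xstar) \<le> \<epsilon> \<and>
         \<not> mass_conserving m u)"
proof (intro allI impI)
  fix \<epsilon> :: real assume "\<epsilon> > 0"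
  have "M > 0" and m0: "0 < m0 $ i" "m0 $ i < M" for i using assms by auto
  obtain w where w: "\<And>i. w i > 0" "(\<Sum>i\<in>UNIV. w i) = 1" "(\<Sum>i\<in>UNIV. w i *\<^sub>R x0 $ i) = xstar"
    using interior_convex_hull_positive_weights[OF assms(8)] by metis
  obtain K where K: "K > 0" "\<And>m x. (\<And>i. 0 \<le> m $ i \<and> m $ i \<le> M) \<Longrightarrow> norm (x - x0) \<le> 1 \<Longrightarrow>
      norm (velocity a M m x) \<le> K"
    using velocity_bounded_near[OF assms(1) \<open>M > 0\<close>] by metis
  \<comment> \<open>The minimum serves two purposes: \<open>K * \<tau> < 1\<close> keeps the agents
    where the bound \<open>K\<close> is valid, and \<open>K * \<tau> \<le> \<epsilon>\<close> is the
    final error.\<close>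
  define \<tau> where "\<tau> = min 1 \<epsilon> / (2 * K)"
  have \<tau>: "\<tau> > 0" "K * \<tau> < 1" "K * \<tau> \<le> \<epsilon>"
    using \<open>\<epsilon> > 0\<close> \<open>K > 0\<close> by (auto simp: \<tau>_def)
  \<comment> \<open>Halving makes \<mu> strictly smaller than every initial mass; as the weights are
    at most 1, all targets \<open>\<mu> * w i\<close> are too.\<close>
  define \<mu> where "\<mu> = Min (range (\<lambda>i. m0 $ i)) / 2"
  have "\<mu> > 0" using m0 by (simp add: \<mu>_def)
  have \<mu>: "\<mu> < m0 $ i" for i
  proof -
    have "Min (range (\<lambda>i. m0 $ i)) \<le> m0 $ i" by (intro Min_le) auto
    then show ?thesis using m0(1)[of i] unfolding \<mu>_def by linarith
  qed
  have target: "0 < \<mu> * w i" "\<mu> * w i < m0 $ i" for i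
  proof -
    show "0 < \<mu> * w i" using \<open>\<mu> > 0\<close> w(1) by simp
    have "w i \<le> 1" using member_le_sum[of i UNIV w] w by (simp add: less_imp_le)
    then have "\<mu> * w i \<le> \<mu>" using \<open>\<mu> > 0\<close> by (simp add: mult_left_le)
    then show "\<mu> * w i < m0 $ i" using \<mu>[of i] by simp
  qed
  define c where "c = (\<chi> i. ln (\<mu> * w i / m0 $ i) / \<tau>)"
  have c: "c $ i < 0" for i
    using target[of i] m0(1)[of i] \<open>\<tau> > 0\<close> by (simp add: c_def divide_neg_pos)
  have hit: "m0 $ i * exp (c $ i * \<tau>) = \<mu> * w i" for i
    using target[of i] m0(1)[of i] \<open>\<tau> > 0\<close> by (simp add: c_def)
  have "norm c + 1 > 0" by (simp add: add_nonneg_pos)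
  have "\<tau> \<ge> 0" using \<tau> by simp
  show "\<exists>\<alpha>>0. \<exists>t\<^sub>\<epsilon>\<ge>0. \<exists>u :: real \<Rightarrow> real^'n.
      u \<in> borel_measurable (lebesgue_on {0..}) \<and>
      (\<forall>t\<ge>0. \<forall>i. \<bar>u t $ i\<bar> \<le> \<alpha>) \<and>
      (\<exists>x m. controlled_solution a M x0 m0 u x m) \<and>
      (\<forall>x m. controlled_solution a M x0 m0 u x m \<longrightarrow>
         norm (barycenter (m t\<^sub>\<epsilon>) (x t\<^sub>\<epsilon>) - xstar) \<le> \<epsilon> \<and>
         \<not> mass_conserving m u)"
  proof (rule exI[of _ "norm c + 1"], rule conjI, fact, rule exI[of _ \<tau>], rule conjI, fact,
      rule exI[of _ "\<lambda>_. c"], intro conjI allI impI)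
    show "(\<lambda>_. c) \<in> borel_measurable (lebesgue_on {0..})" by simp
    show "\<bar>c $ i\<bar> \<le> norm c + 1" for i using component_le_norm_cart[of c i] by simp
    show "\<exists>x m. controlled_solution a M x0 m0 (\<lambda>_. c) x m"
      by (rule controlled_solution_const_exists[OF assms(1,2,4) \<open>M > 0\<close>, of _ M])
        (use m0 c in \<open>auto intro: less_imp_le\<close>)
    fix x m assume sol: "controlled_solution a M x0 m0 (\<lambda>_. c) x m"
    have m: "m t $ i = m0 $ i * exp (c $ i * t)" if "t \<ge> 0" for t i
      using controlled_solution_const_masses[OF sol that] .
    have mM: "0 \<le> m t $ i \<and> m t $ i \<le> M" if "t \<ge> 0" for t i
    proof -
      have "exp (c $ i * t) \<le> 1" using c[of i] that by (simp add: mult_nonpos_nonneg less_imp_le)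
      then have "m0 $ i * exp (c $ i * t) \<le> m0 $ i" using m0(1)[of i] by (simp add: mult_left_le)
      then show ?thesis using m0[of i] m[OF that, of i] by (metis exp_ge_zero less_imp_le mult_nonneg_nonneg order_trans)
    qed
    have "x 0 = x0" using sol by (simp add: controlled_solution_def)
    have "norm (x \<tau> - x 0) \<le> K * \<tau>"
    proof (rule norm_diff_le_while_derivative_bounded)
      show "(x has_vector_derivative velocity a M (m t) (x t)) (at t within {0..})" if "t \<ge> 0" for t
        using controlled_solution_positions[OF sol assms(1) that] .
      show "norm (velocity a M (m t) (x t)) \<le> K" if "t \<ge> 0" "norm (x t - x 0) \<le> 1" for t
        using K(2)[OF mM[OF that(1)]] that(2) \<open>x 0 = x0\<close> by simp
    qed (use \<open>K > 0\<close> \<tau> in auto)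
    then have near: "norm (x \<tau> - x0) \<le> \<epsilon>" using \<tau> \<open>x 0 = x0\<close> by simp
    have m\<tau>: "m \<tau> $ i = \<mu> * w i" for i using m[of \<tau> i] hit[of i] \<tau> by simp
    have "(\<Sum>i\<in>UNIV. m \<tau> $ i) = \<mu>"
      by (simp add: m\<tau> sum_distrib_left[symmetric] w(2))
    moreover have "(\<Sum>i\<in>UNIV. m \<tau> $ i *\<^sub>R x \<tau> $ i) = \<mu> *\<^sub>R (\<Sum>i\<in>UNIV. w i *\<^sub>R x \<tau> $ i)"
      by (simp add: m\<tau> scaleR_sum_right)
    ultimately have "barycenter (m \<tau>) (x \<tau>) = (\<Sum>i\<in>UNIV. w i *\<^sub>R x \<tau> $ i)"
      using \<open>\<mu> > 0\<close> by (simp add: barycenter_def)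
    \<comment> \<open>The factor \<mu> has cancelled. Both points are now averages with the same
      weights, so their distance is at most a weighted mean of the displacements of the
      agents.\<close>
    then have "barycenter (m \<tau>) (x \<tau>) - xstar = (\<Sum>i\<in>UNIV. w i *\<^sub>R (x \<tau> - x0) $ i)"
      by (simp add: w(3)[symmetric] sum_subtractf scaleR_diff_right)
    also have "norm \<dots> \<le> (\<Sum>i\<in>UNIV. w i * norm (x \<tau> - x0))"
      using w(1) Finite_Cartesian_Product.norm_nth_le[of "x \<tau> - x0"]
      by (intro sum_norm_le) (auto intro!: mult_mono simp: less_imp_le simp del: vector_minus_component)
    also have "\<dots> = norm (x \<tau> - x0)" by (simp add: sum_distrib_right[symmetric] w(2))
    finally show "norm (barycenter (m \<tau>) (x \<tau>) - xstar) \<le> \<epsilon>" using near by simp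
    show "\<not> mass_conserving m (\<lambda>_. c)"
    proof
      assume "mass_conserving m (\<lambda>_. c)"
      then have "AE t in lebesgue_on {0::real..}. (\<Sum>i\<in>UNIV. m t $ i * c $ i) = 0"
        by (simp add: mass_conserving_def)
      \<comment> \<open>The total mass has a strictly negative rate at every time, so a rate that
        vanishes almost everywhere would make the half line a null set.\<close>
      moreover have "AE t in lebesgue_on {0::real..}. (\<Sum>i\<in>UNIV. m t $ i * c $ i) < 0"
      proof (rule AE_I2)
        fix t assume "t \<in> space (lebesgue_on {0::real..})"
        then have "m t $ i * c $ i < 0" for i
          using m[of t i] m0(1)[of i] c[of i] by (simp add: mult_pos_neg)
        then have "(\<Sum>i\<in>UNIV. m t $ i * c $ i) < (\<Sum>i\<in>(UNIV :: 'n set). 0)"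
          by (intro sum_strict_mono) auto
        then show "(\<Sum>i\<in>UNIV. m t $ i * c $ i) < 0" by simp
      qed
      ultimately have "AE t in lebesgue_on {0::real..}. False" by eventually_elim simp
      then have "AE t in lebesgue. t \<notin> {0::real..}"
        by (subst (asm) AE_restrict_space_iff) auto
      then have "{0::real..} \<in> null_sets lebesgue" by (simp add: AE_iff_null_sets)
      then have "{0..1::real} \<in> null_sets lebesgue"
        by (rule null_sets_subset) auto
      then show False by (simp add: null_sets_def)
    qed
  qed
qed

end
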